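(* Let $r\ge 3$ and $\ell\ge 2$ be integers. Suppose that for every positive integer $n$ there exists an $n$-vertex $r$-graph of girth $2\ell+2$ with $n^{1+1/\ell-o(1)}$ edges. Then \[ s(C^r_{2\ell+1})\ge \frac{1}{(r-1)\ell-1}, \] and consequently, for every constant $0<\delta<1$, there exist $n$-vertex $r$-graphs with at least $n^{r-\delta}$ edges containing at most \[ n^{(r-1)(2\ell+1)-\delta\left(2\ell+1+\frac{1}{(r-1)\ell-1}\right)+o(1)} \] copies of $C^r_{2\ell+1}$.
   Context: An $r$-graph is an $r$-uniform hypergraph; $v(F)$, $e(F)$ denote the numbers of vertices and edges of $F$. The $r$-uniform linear cycle of length $k$, $C^r_{k}$, is the $r$-graph with $k$ edges $e_1,\dots,e_k$ where $e_i=\{v_{(r-1)(i-1)},v_{(r-1)(i-1)+1},\dots,v_{(r-1)i}\}$ (indices of vertices taken with $v_0=v_{(r-1)k}$). A homomorphism from an $r$-graph $F$ to an $r$-graph $H$ is a map $\phi:V(F)\to V(H)$ with $\phi(e)\in E(H)$ for all $e\in E(F)$; $\hom(F,H)$ is their number and $t_F(H)=\hom(F,H)/v(H)^{v(F)}$. $K^r_r$ is the $r$-graph with a single edge. For an $r$-partite $r$-graph $F$, the Sidorenko gap is $s(F)=\sup\{s:\exists H,\ t_F(H)=t_{K^r_r}(H)^{s+e(F)}>0\}$. A Berge cycle of length $k$ in a hypergraph consists of $k$ distinct vertices $v_1,\dots,v_k$ and $k$ distinct edges $e_1,\dots,e_k$ with $\{v_i,v_{i+1}\}\subset e_i$ (indices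 mod $k$); the girth is the length of a shortest Berge cycle (two distinct edges sharing at least two vertices form a Berge cycle of length 2). $o(1)$ denotes a function tending to $0$ as $n\to\infty$. *)

theory Defs
  imports Complex_Main "HOL-Library.FuncSet" "HOL-Library.Extended_Real"
begin

text \<open>A hypergraph is a pair (vertex set, edge set).\<close>

type_synonym 'a hgraph = "'a set \<times> 'a set set"

abbreviation verts :: "'a hgraph \<Rightarrow> 'a set" where
  "verts H \<equiv> fst H"

abbreviation edges :: "'a hgraph \<Rightarrow> 'a set set" where
  "edges H \<equiv> snd H"

definition r_graph :: "nat \<Rightarrow> 'a hgraph \<Rightarrow> bool" where
  "r_graph r H \<longleftrightarrow>
     finite (verts H) \<and> (\<forall>e \<in> edges H. e \<subseteq> verts H \<and> card e = r)"

definition single_edge :: "nat \<Rightarrow> nat hgraph" where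
  "single_edge r = ({..<r}, {{..<r}})"

text \<open>The edges are indexed from 0: edge i consists of the vertices
  (r-1)i, (r-1)i + 1, ..., (r-1)(i+1), and the reduction modulo (r-1)k identifies
  the last vertex of the last edge with the vertex 0.\<close>

definition linear_cycle :: "nat \<Rightarrow> nat \<Rightarrow> nat hgraph" where
  "linear_cycle r k =
     ({..<(r - 1) * k},
      (\<lambda>i. (\<lambda>j. ((r - 1) * i + j) mod ((r - 1) * k)) ` {..r - 1}) ` {..<k})"

definition homs :: "'a hgraph \<Rightarrow> 'b hgraph \<Rightarrow> ('a \<Rightarrow> 'b) set" where
  "homs F H = {\<phi> \<in> verts F \<rightarrow>\<^sub>E verts H. \<forall>e \<in> edges F. \<phi> ` e \<in> edges H}"

definition hom_density :: "'a hgraph \<Rightarrow> 'b hgraph \<Rightarrow> real" where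
  "hom_density F H = real (card (homs F H)) / real (card (verts H)) ^ card (verts F)"

text \<open>The supremum is taken in the extended reals, so that it is meaningful without a
  prior proof that the set is nonempty and bounded above. Every finite hypergraph is
  isomorphic to one whose vertices are natural numbers, so H may be taken of that type.\<close>

definition sidorenko_gap :: "nat \<Rightarrow> 'a hgraph \<Rightarrow> ereal" where
  "sidorenko_gap r F =
     Sup {ereal s | s. \<exists>H :: nat hgraph. r_graph r H \<and>
            hom_density F H = hom_density (single_edge r) H powr (s + real (card (edges F))) \<and>
            hom_density F H > 0}"

text \<open>The condition 2 \<le> k excludes the degenerate case of one vertex in one edge.\<close>

definition berge_cycle ::
  "'a hgraph \<Rightarrow> nat \<Rightarrow> (nat \<Rightarrow> 'a) \<Rightarrow> (nat \<Rightarrow> 'a set) \<Rightarrow> bool" where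
  "berge_cycle H k v e \<longleftrightarrow>
     2 \<le> k \<and> inj_on v {..<k} \<and> inj_on e {..<k} \<and>
     (\<forall>i<k. v i \<in> verts H \<and> e i \<in> edges H \<and> {v i, v (Suc i mod k)} \<subseteq> e i)"

text \<open>The girth is infinite if there is no Berge cycle.\<close>

definition girth :: "'a hgraph \<Rightarrow> enat" where
  "girth H = Inf {enat k | k. \<exists>v e. berge_cycle H k v e}"

definition isomorphic :: "'a hgraph \<Rightarrow> 'b hgraph \<Rightarrow> bool" where
  "isomorphic F H \<longleftrightarrow>
     (\<exists>f. bij_betw f (verts F) (verts H) \<and> (`) f ` edges F = edges H)"

text \<open>Copies are counted as (unlabelled) subhypergraphs.\<close>

definition copies :: "'a hgraph \<Rightarrow> 'b hgraph \<Rightarrow> 'b hgraph set" where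
  "copies F H = {(V, E). V \<subseteq> verts H \<and> E \<subseteq> edges H \<and> isomorphic F (V, E)}"

end

theory Submission
  imports Defs
begin

text \<open>
  If $H$ has girth greater than $2\ell+1$, the image of $C^r_{2\ell+1}$ under a homomorphism to
  $H$ is a closed walk in a hyperforest. Such a walk traverses each of its edges at least twice,
  hence uses at most $\ell$ distinct edges, so $\hom(C^r_{2\ell+1},H) = O(n\Delta^\ell)$, where
  $\Delta$ is the maximum degree. After deleting edges until all nonzero degrees are at least
  $n^{1/\ell-o(1)}$, the Moore bound around a vertex of degree $\Delta$ yields
  $\Delta\le n^{1/\ell+o(1)}$, and $\hom(C^r_{2\ell+1},H)\le n^{2+o(1)}$.
  The bound on the gap results from comparing densities, and balanced blow-ups of such an $H$ on
  about $n^{\delta/(r-1-1/\ell)}$ vertices have few copies of the cycle.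
\<close>

section \<open>Short walks and Berge cycles\<close>

text \<open>Let \<open>a = r - 1 - 1/l\<close> and let \<open>b\<close> be the number of vertices of
  the cycle minus 2, so that the edge density is about n^(-a) and the cycle density at most about
  n^(-b). Then b = (2l + 1) a + 1/l, and dividing the surplus 1/l by \<open>a\<close> gives exactly
  1/((r-1)l - 1). The surplus is due to the odd length: for length 2l the same count, with
  \<open>b\<close> again the number of vertices minus 2, gives b = 2l a and no gap, and the
  additional edge of the odd cycle does not raise the exponent of the count. The obstacle is that
  the given graphs come with many edges but no control of degrees, while the count depends on the
  maximum degree. The Moore bound converts a lower bound on degrees into an upper bound, and pruning
  supplies the lower bound. Error terms are handled with a fixed loss in each exponent. Only at the
  end does the loss disappear: by a limit in the bound on the gap, and by taking the smallest
  attainable count for the copies.\<close>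

primrec reach :: "'a set set \<Rightarrow> 'a \<Rightarrow> nat \<Rightarrow> 'a set" where
  "reach E v 0 = {v}"
| "reach E v (Suc i) = reach E v i \<union> \<Union>{e \<in> E. e \<inter> reach E v i \<noteq> {}}"

lemma reach_step:
  assumes "x \<in> reach E v i" "e \<in> E" "x \<in> e" "y \<in> e"
  shows "y \<in> reach E v (Suc i)"
  using assms by auto

lemma reach_mono: "i \<le> j \<Longrightarrow> reach E v i \<subseteq> reach E v j"
  by (rule lift_Suc_mono_le[of "reach E v"]) auto

lemma reach_trans:
  assumes "y \<in> reach E x i" "z \<in> reach E y j"
  shows "z \<in> reach E x (i + j)"
  using assms(2)
proof (induction j arbitrary: z)
  case 0
  then show ?case using assms(1) by simp
next
  case (Suc j)
  then consider "z \<in> reach E y j" | e w where "e \<in> E" "w \<in> e" "z \<in> e" "w \<in> reach E y j"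
    by auto
  then show ?case
  proof cases
    case 1
    then show ?thesis using Suc.IH by auto
  next
    case 2
    then show ?thesis using Suc.IH[of w] reach_step[of w E x "i + j" e z] by simp
  qed
qed

lemma reach_sym:
  assumes "y \<in> reach E x i"
  shows "x \<in> reach E y i"
  using assms
proof (induction i arbitrary: y)
  case 0
  then show ?case by simp
next
  case (Suc i)
  then consider "y \<in> reach E x i" | e w where "e \<in> E" "w \<in> e" "y \<in> e" "w \<in> reach E x i"
    by auto
  then show ?case
  proof cases
    case 1
    then show ?thesis using Suc.IH by auto
  next
    case 2
    have "w \<in> reach E y 1" using 2 by auto
    from reach_trans[OF this Suc.IH[OF 2(4)]] show ?thesis by simp
  qed
qed

text \<open>\<open>reach E v i\<close> is the ball of radius i. Each step of a walk that it records
  uses an edge meeting a smaller ball, so an edge that misses those balls can be deleted without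
  losing the walk.\<close>

lemma reach_avoid:
  assumes "y \<in> reach E v i" "\<And>j. j < i \<Longrightarrow> g \<inter> reach E v j = {}"
  shows "y \<in> reach (E - {g}) v i"
  using assms
proof (induction i arbitrary: y)
  case 0
  then show ?case by simp
next
  case (Suc i)
  have IH: "w \<in> reach (E - {g}) v i" if "w \<in> reach E v i" for w
    using Suc.IH[OF that] Suc.prems(2) by simp
  from Suc.prems(1) consider "y \<in> reach E v i" | e w where "e \<in> E" "w \<in> e" "y \<in> e" "w \<in> reach E v i"
    by auto
  then show ?case
  proof cases
    case 1
    then show ?thesis using IH by auto
  next
    case 2
    then have "e \<noteq> g" using Suc.prems(2)[of i] by auto
    then show ?thesis using 2 IH[of w] reach_step[of w "E - {g}" v i e y] by simp
  qed
qed

text \<open>On a shortest walk \<open>x j\<close> has distance exactly j from \<open>v\<close>; this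
  is what makes vertices and edges distinct when the walk is closed up to a Berge cycle.\<close>

lemma geodesic:
  assumes "u \<in> reach E v m" "\<And>j. j < m \<Longrightarrow> u \<notin> reach E v j"
  shows "\<exists>x g. x 0 = v \<and> x m = u \<and> (\<forall>j\<le>m. x j \<in> reach E v j \<and> (\<forall>i<j. x j \<notin> reach E v i)) \<and>
           (\<forall>j<m. g j \<in> E \<and> x j \<in> g j \<and> x (Suc j) \<in> g j)"
  using assms
proof (induction m arbitrary: u)
  case 0
  then show ?case by (intro exI[of _ "\<lambda>_. v"]) auto
next
  case (Suc m)
  then have "u \<notin> reach E v m" by blast
  then obtain e w where e: "e \<in> E" "w \<in> e" "u \<in> e" "w \<in> reach E v m"
    using Suc.prems(1) by auto
  have "w \<notin> reach E v j" if "j < m" for j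
    using Suc.prems(2)[of "Suc j"] that reach_step[of w E v j e u] e by blast
  then obtain x g where xg: "x 0 = v" "x m = w"
    "\<forall>j\<le>m. x j \<in> reach E v j \<and> (\<forall>i<j. x j \<notin> reach E v i)"
    "\<forall>j<m. g j \<in> E \<and> x j \<in> g j \<and> x (Suc j) \<in> g j"
    using Suc.IH[OF e(4)] by blast
  let ?x = "x(Suc m := u)" and ?g = "g(m := e)"
  have "\<forall>j\<le>Suc m. ?x j \<in> reach E v j \<and> (\<forall>i<j. ?x j \<notin> reach E v i)"
    using xg(3) Suc.prems by (simp add: le_Suc_eq del: reach.simps(2))
  moreover have "\<forall>j<Suc m. ?g j \<in> E \<and> ?x j \<in> ?g j \<and> ?x (Suc j) \<in> ?g j"
    using xg(2,4) e by (auto simp: less_Suc_eq)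
  ultimately show ?case using xg(1) by (intro exI[of _ ?x] exI[of _ ?g]) simp
qed

text \<open>Girth greater than \<open>m\<close>. Unlike an exact value of the girth, this passes to
  subhypergraphs, as pruning requires.\<close>

definition berge_free :: "'a hgraph \<Rightarrow> nat \<Rightarrow> bool" where
  "berge_free H m \<longleftrightarrow> (\<forall>k\<le>m. \<forall>v e. \<not> berge_cycle H k v e)"

lemma berge_free_girth: "girth H = enat (Suc m) \<Longrightarrow> berge_free H m"
proof -
  assume g: "girth H = enat (Suc m)"
  have "False" if "k \<le> m" "berge_cycle H k v e" for k v e
  proof -
    have "girth H \<le> enat k" unfolding girth_def using that(2) by (intro Inf_lower) auto
    then show False using g that(1) by simp
  qed
  then show ?thesis by (auto simp: berge_free_def)
qed

lemma berge_free_subgraph: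
  assumes "berge_free (V, E) m" "E' \<subseteq> E"
  shows "berge_free (V, E') m"
  using assms unfolding berge_free_def berge_cycle_def by (simp, blast)

text \<open>A shortest walk from \<open>u\<close> to \<open>v\<close> avoiding \<open>f\<close> has
  t <= j edges and closes up with \<open>f\<close> to a Berge cycle of length t + 1 <= m. All later
  arguments use the girth condition through this lemma.\<close>

lemma not_reach_avoiding:
  assumes "berge_free H m" "Suc j \<le> m" and sub: "\<And>e. e \<in> edges H \<Longrightarrow> e \<subseteq> verts H"
    and f: "f \<in> edges H" "u \<in> f" "v \<in> f" "u \<noteq> v"
  shows "v \<notin> reach (edges H - {f}) u j"
proof
  let ?E = "edges H - {f}"
  assume v: "v \<in> reach ?E u j"
  define t where "t = (LEAST j. v \<in> reach ?E u j)"
  have t: "v \<in> reach ?E u t" unfolding t_def using v by (rule LeastI)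
  have tj: "t \<le> j" unfolding t_def using v by (rule Least_le)
  have tmin: "\<And>j. j < t \<Longrightarrow> v \<notin> reach ?E u j" unfolding t_def by (rule not_less_Least)
  from geodesic[OF t tmin] obtain x g where xg: "x 0 = u" "x t = v"
    "\<forall>j\<le>t. x j \<in> reach ?E u j \<and> (\<forall>i<j. x j \<notin> reach ?E u i)"
    "\<forall>j<t. g j \<in> ?E \<and> x j \<in> g j \<and> x (Suc j) \<in> g j" by blast
  define e where "e = g(t := f)"
  have "t \<noteq> 0" using xg(1,2) f(4) by metis
  have injx: "inj_on x {..<Suc t}"
  proof (rule linorder_inj_onI')
    fix i j assume "i \<in> {..<Suc t}" "j \<in> {..<Suc t}" "i < j"
    then show "x i \<noteq> x j" using xg(3) by (metis lessThan_iff less_Suc_eq_le)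
  qed
  have inje: "inj_on e {..<Suc t}"
  proof (rule linorder_inj_onI')
    fix i j assume ij: "i \<in> {..<Suc t}" "j \<in> {..<Suc t}" "i < j"
    show "e i \<noteq> e j"
    proof (cases "j = t")
      case True
      then show ?thesis using xg(4) ij by (auto simp: e_def)
    next
      case False
      then have j: "j < t" "i < t" using ij by auto
      \<comment> \<open>If the two edges coincided, \<open>x (Suc j)\<close> would share an edge
        with \<open>x i\<close> and have distance at most i + 1, but its distance is j + 1.\<close>
      have "g i \<noteq> g j"
      proof
        assume eq: "g i = g j"
        have "x (Suc j) \<in> reach ?E u (Suc i)"
          using xg(3)[rule_format, of i] xg(4) j eq
          by (intro reach_step[of "x i" _ _ _ "g i"]) auto
        moreover have "Suc i < Suc j" using ij by simp
        ultimately show False using xg(3) j by (metis Suc_leI)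
      qed
      then show ?thesis using j by (simp add: e_def)
    qed
  qed
  have "berge_cycle H (Suc t) x e"
    unfolding berge_cycle_def
  proof (intro conjI allI impI)
    show "2 \<le> Suc t" using \<open>t \<noteq> 0\<close> by simp
    fix i assume i: "i < Suc t"
    show ei: "e i \<in> edges H" using i xg(4) f(1) by (auto simp: e_def less_Suc_eq)
    show xe: "{x i, x (Suc i mod Suc t)} \<subseteq> e i"
      using i xg f by (cases "i = t") (auto simp: e_def)
    then show "x i \<in> verts H" using sub[OF ei] by auto
  qed (use injx inje in auto)
  then show False using assms(1,2) tj by (auto simp: berge_free_def)
qed

section \<open>The Moore bound\<close>

locale berge_free_graph =
  fixes H :: "'a hgraph" and r l :: nat
  assumes rg: "r_graph r H" and r2: "2 \<le> r" and bf: "berge_free H (2 * l)"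
begin

abbreviation "E \<equiv> edges H"

lemma edge_sub: "e \<in> E \<Longrightarrow> e \<subseteq> verts H" and edge_card: "e \<in> E \<Longrightarrow> card e = r"
  and finV: "finite (verts H)"
  using rg by (auto simp: r_graph_def)

lemma finE: "finite E"
  using edge_sub finV by (meson Pow_iff finite_Pow_iff finite_subset subsetI)

lemma edge_other: "e \<in> E \<Longrightarrow> \<exists>y. y \<in> e \<and> y \<noteq> u"
proof (rule ccontr)
  assume e: "e \<in> E" and "\<not> ?thesis"
  then have "e \<subseteq> {u}" by auto
  then have "card e \<le> 1" using card_mono[of "{u}" e] by simp
  then show False using edge_card[OF e] r2 by simp
qed

text \<open>With two such edges, the walk from \<open>u\<close> through \<open>g\<close> to
  \<open>y\<close>, back to \<open>v\<close> and out to \<open>y'\<close> has length 2i + 1 and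
  avoids \<open>g'\<close>, so that \<open>g'\<close> closes it within length 2i + 2 <= 2l.\<close>

lemma parent_unique:
  assumes "Suc i \<le> l" "u \<notin> reach E v i" "g \<in> E" "g' \<in> E" "u \<in> g" "u \<in> g'"
    "y \<in> g" "y \<in> reach E v i" "y' \<in> g'" "y' \<in> reach E v i"
  shows "g = g'"
proof (rule ccontr)
  assume ne: "g \<noteq> g'"
  let ?F = "E - {g'}"
  \<comment> \<open>If \<open>g'\<close> met a smaller ball, \<open>u\<close> would already lie in
    the ball of radius i.\<close>
  have av: "g' \<inter> reach E v j = {}" if "j < i" for j
  proof (rule ccontr)
    assume "\<not> ?thesis"
    then have "u \<in> reach E v (Suc j)" using assms by (auto intro: reach_step simp del: reach.simps)
    then show False using assms(2) reach_mono[of "Suc j" i E v] that by auto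
  qed
  have "y \<in> reach ?F v i" "y' \<in> reach ?F v i" using reach_avoid assms av by metis+
  then have "y' \<in> reach ?F y (i + i)" using reach_trans reach_sym by metis
  moreover have "y \<in> reach ?F u 1" using assms ne by auto
  ultimately have "y' \<in> reach ?F u (1 + (i + i))" using reach_trans by metis
  moreover have "u \<noteq> y'" using assms by auto
  ultimately show False
    using not_reach_avoiding[OF bf, of "1 + (i + i)" g' u y'] edge_sub assms by auto
qed

text \<open>An edge missing the ball of radius i has at most one vertex in the next ball: walks from
  \<open>v\<close> to two such vertices avoid \<open>h\<close> and would close up with it within
  length 2i + 3.\<close>

lemma no_sideways:
  assumes "Suc i < l" "h \<in> E" "u \<in> h" "y \<in> h" "u \<noteq> y"
    "u \<in> reach E v (Suc i)" "h \<inter> reach E v i = {}"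
  shows "y \<notin> reach E v (Suc i)"
proof
  assume y: "y \<in> reach E v (Suc i)"
  let ?F = "E - {h}"
  have av: "h \<inter> reach E v j = {}" if "j < Suc i" for j
    using assms(7) reach_mono[of j i E v] that by auto
  have "y \<in> reach ?F v (Suc i)" "u \<in> reach ?F v (Suc i)" using reach_avoid assms y av by metis+
  then have "y \<in> reach ?F u (Suc i + Suc i)" using reach_trans reach_sym by metis
  then show False
    using not_reach_avoiding[OF bf, of "Suc i + Suc i" h u y] edge_sub assms by auto
qed

definition deg :: "'a \<Rightarrow> nat" where "deg u = card {e \<in> E. u \<in> e}"

definition layer :: "'a \<Rightarrow> nat \<Rightarrow> 'a set" where
  "layer v i = reach E v (Suc i) - reach E v i"

lemma layer_sub: "layer v i \<subseteq> \<Union>E"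
  by (auto simp: layer_def)

lemma layer_finite: "finite (layer v i)"
  by (rule finite_subset[OF layer_sub]) (use finE edge_sub finV finite_subset in blast)

text \<open>By \<open>parent_unique\<close> with radius 0, two edges at \<open>v\<close> share no
  other vertex, so one further vertex chosen in each edge gives distinct neighbours.\<close>

lemma layer_0: "1 \<le> l \<Longrightarrow> deg v \<le> card (layer v 0)"
proof -
  assume l: "1 \<le> l"
  define c where "c e = (SOME y. y \<in> e \<and> y \<noteq> v)" for e
  have c: "c e \<in> e" "c e \<noteq> v" if "e \<in> E" for e
    using someI_ex[OF edge_other[OF that, of v]] by (auto simp: c_def)
  have "inj_on c {e \<in> E. v \<in> e}"
  proof (rule inj_onI)
    fix e e' assume "e \<in> {e \<in> E. v \<in> e}" "e' \<in> {e \<in> E. v \<in> e}" "c e = c e'"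
    then show "e = e'" using parent_unique[of 0 "c e" v e e' v v] c[of e] c[of e'] l by auto
  qed
  moreover have "c ` {e \<in> E. v \<in> e} \<subseteq> layer v 0"
    using c by (auto simp: layer_def)
  ultimately show ?thesis unfolding deg_def using card_inj_on_le layer_finite by blast
qed

lemma layer_Suc:
  assumes "Suc i < l" and d: "\<And>u. u \<in> \<Union>E \<Longrightarrow> Suc d \<le> deg u"
  shows "d * card (layer v i) \<le> card (layer v (Suc i))"
proof -
  let ?D = "\<lambda>u. {h \<in> E. u \<in> h \<and> h \<inter> reach E v i = {}}"
  let ?P = "Sigma (layer v i) ?D"
  \<comment> \<open>Only one edge at \<open>u\<close> leads back towards \<open>v\<close>; each of the others reaches a vertex of the next
    layer, and these vertices are distinct.\<close>
  have D: "d \<le> card (?D u)" if u: "u \<in> layer v i" for u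
  proof -
    let ?A = "{h \<in> E. u \<in> h \<and> h \<inter> reach E v i \<noteq> {}}"
    have "card ?A \<le> 1"
    proof -
      have "g = g'" if "g \<in> ?A" "g' \<in> ?A" for g g'
        using that u assms(1) parent_unique[of i u v g g'] by (auto simp: layer_def)
      then show ?thesis using card_le_Suc0_iff_eq[of ?A] finE by auto
    qed
    moreover have "{e \<in> E. u \<in> e} = ?D u \<union> ?A" by auto
    then have "deg u = card (?D u \<union> ?A)" by (simp add: deg_def)
    then have "deg u \<le> card (?D u) + card ?A" using card_Un_le[of "?D u" ?A] by linarith
    moreover have "u \<in> \<Union>E" using u layer_sub by blast
    then have "Suc d \<le> deg u" by (rule d)
    ultimately show ?thesis by linarith
  qed
  define c where "c = (\<lambda>(u, e). SOME y. y \<in> e \<and> y \<noteq> (u::'a))"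
  have c: "c (u, e) \<in> e" "c (u, e) \<noteq> u" if "e \<in> E" for u e
    using someI_ex[OF edge_other[OF that, of u]] by (auto simp: c_def)
  have cl: "c (u, h) \<notin> reach E v (Suc i)" if "(u, h) \<in> ?P" for u h
    using that c[of h u] no_sideways[OF assms(1), of h u "c (u, h)" v] by (auto simp: layer_def)
  \<comment> \<open>A vertex of the new layer determines its edge back by
    \<open>parent_unique\<close>, and that edge determines its vertex in the old layer by
    \<open>no_sideways\<close>.\<close>
  have "inj_on c ?P"
  proof (rule inj_onI)
    fix p p' assume p: "p \<in> ?P" "p' \<in> ?P" "c p = c p'"
    obtain u h u' h' where ph: "p = (u, h)" "p' = (u', h')" by fastforce
    have "h = h'"
      by (rule parent_unique[of "Suc i" "c p" v h h' u u'])
        (use p ph assms(1) c[of h u] c[of h' u'] cl[of u h] in \<open>auto simp: layer_def simp del: reach.simps\<close>)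
    moreover have "u = u'"
      using no_sideways[OF assms(1), of h u u' v] p ph calculation by (auto simp: layer_def)
    ultimately show "p = p'" using ph by simp
  qed
  moreover have "c ` ?P \<subseteq> layer v (Suc i)"
  proof
    fix y assume "y \<in> c ` ?P"
    then obtain u h where p: "(u, h) \<in> ?P" "y = c (u, h)" by fastforce
    moreover have "y \<in> reach E v (Suc (Suc i))"
      using p c[of h u] reach_step[of u E v "Suc i" h y] by (auto simp: layer_def)
    ultimately show "y \<in> layer v (Suc i)" using cl by (simp add: layer_def)
  qed
  ultimately have "card ?P \<le> card (layer v (Suc i))" using card_inj_on_le layer_finite by blast
  moreover have "card ?P = (\<Sum>u\<in>layer v i. card (?D u))"
    using layer_finite finE by (subst card_SigmaI) auto
  moreover have "(\<Sum>u\<in>layer v i. d) \<le> (\<Sum>u\<in>layer v i. card (?D u))"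
    using D by (rule sum_mono)
  ultimately show ?thesis by (simp add: mult.commute)
qed

text \<open>The degree of \<open>v\<close> itself counts the first layer and the minimum degree only
  drives the growth of the l - 1 later ones. Hence a lower bound on all degrees bounds the maximum
  degree from above.\<close>

lemma moore_bound:
  assumes "1 \<le> l" and d: "\<And>u. u \<in> \<Union>E \<Longrightarrow> Suc d \<le> deg u"
  shows "deg v * d ^ (l - 1) \<le> card (verts H)"
proof -
  have "deg v * d ^ i \<le> card (layer v i)" if "i < l" for i
    using that
  proof (induction i)
    case 0
    then show ?case using layer_0 assms(1) by simp
  next
    case (Suc i)
    then have "d * (deg v * d ^ i) \<le> d * card (layer v i)" by simp
    also have "\<dots> \<le> card (layer v (Suc i))" using layer_Suc Suc.prems d by blast
    finally show ?case by (simp add: algebra_simps)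
  qed
  then have "deg v * d ^ (l - 1) \<le> card (layer v (l - 1))" using assms(1) by simp
  also have "\<dots> \<le> card (verts H)"
    using layer_sub edge_sub finV by (intro card_mono) blast+
  finally show ?thesis .
qed

end

section \<open>Pruning to a large minimum degree\<close>

lemma prune_min_degree:
  assumes "r_graph r H"
  shows "\<exists>E'\<subseteq>edges H. int (card E') \<ge> int (card (edges H)) - int d * int (card (verts H)) \<and>
           (\<forall>u\<in>\<Union>E'. d \<le> card {e \<in> E'. u \<in> e})"
proof -
  have finV: "finite (verts H)" and sub: "\<And>e. e \<in> edges H \<Longrightarrow> e \<subseteq> verts H"
    using assms by (auto simp: r_graph_def)
  have finE: "finite (edges H)"
    using sub finV by (meson Pow_iff finite_Pow_iff finite_subset subsetI)
  \<comment> \<open>Take \<open>U\<close> maximising the number of edges inside \<open>U\<close> minus \<open>d * card U\<close>: then removing a vertex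
    of \<open>U\<close> must destroy at least \<open>d\<close> edges.\<close>
  define I where "I U = {e \<in> edges H. e \<subseteq> U}" for U
  define F where "F U = int (card (I U)) - int d * int (card U)" for U
  have fin: "finite (F ` Pow (verts H))" using finV by simp
  have ne: "F ` Pow (verts H) \<noteq> {}" by auto
  obtain U where U: "U \<subseteq> verts H" "F U = Max (F ` Pow (verts H))"
    using Max_in[OF fin ne] by auto
  have le: "F W \<le> F U" if "W \<subseteq> verts H" for W
    unfolding U(2) using that fin by (intro Max_ge) auto
  have finU: "finite U" using U(1) finV finite_subset by blast
  have finI: "finite (I W)" for W unfolding I_def using finE by simp
  have "I (verts H) = edges H" unfolding I_def using sub by auto
  then have "int (card (I U)) \<ge> int (card (edges H)) - int d * int (card (verts H))"
    using le[of "verts H"] by (simp add: F_def) (smt (verit) mult_nonneg_nonneg of_nat_0_le_iff)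
  moreover have "d \<le> card {e \<in> I U. u \<in> e}" if u: "u \<in> \<Union>(I U)" for u
  proof -
    have uU: "u \<in> U" using u by (auto simp: I_def)
    have "I U = I (U - {u}) \<union> {e \<in> I U. u \<in> e}" by (auto simp: I_def)
    moreover have "I (U - {u}) \<inter> {e \<in> I U. u \<in> e} = {}" by (auto simp: I_def)
    moreover have "finite {e \<in> I U. u \<in> e}" using finI[of U] by simp
    ultimately have "card (I U) = card (I (U - {u})) + card {e \<in> I U. u \<in> e}"
      using card_Un_disjoint[OF finI] by metis
    moreover have "card U = Suc (card (U - {u}))"
      using uU finU by (metis card_Suc_Diff1)
    moreover have "F (U - {u}) \<le> F U" using U(1) by (intro le) auto
    ultimately show ?thesis by (simp add: F_def algebra_simps)
  qed
  ultimately show ?thesis by (intro exI[of _ "I U"]) (auto simp: I_def)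
qed

section \<open>Homomorphisms from linear cycles\<close>

lemma card_le_fibres:
  assumes "finite A" "finite B" "g ` A \<subseteq> B" "\<And>y. y \<in> B \<Longrightarrow> card {x \<in> A. g x = y} \<le> c"
  shows "card A \<le> card B * c"
proof -
  have "card A = (\<Sum>y\<in>g ` A. card {x \<in> A. g x = y})"
    using sum.image_gen[OF assms(1), of "\<lambda>_. 1::nat" g] by simp
  also have "\<dots> \<le> (\<Sum>y\<in>g ` A. c)" using assms(3,4) by (intro sum_mono) auto
  also have "\<dots> \<le> card B * c" using card_mono[OF assms(2,3)] by simp
  finally show ?thesis .
qed

lemma card_image_le_half:
  assumes "finite A" "\<And>x. x \<in> A \<Longrightarrow> \<exists>y\<in>A. y \<noteq> x \<and> g y = g x"
  shows "2 * card (g ` A) \<le> card A"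
proof -
  have "2 \<le> card {x \<in> A. g x = y}" if y: "y \<in> g ` A" for y
  proof -
    obtain x where x: "x \<in> A" "g x = y" using y by auto
    then obtain x' where "x' \<in> A" "x' \<noteq> x" "g x' = y" using assms(2)[of x] by auto
    then have "{x, x'} \<subseteq> {x \<in> A. g x = y}" "card {x, x'} = 2" using x by auto
    then show ?thesis using card_mono[of "{x \<in> A. g x = y}" "{x, x'}"] assms(1) by simp
  qed
  then have "(\<Sum>y\<in>g ` A. 2) \<le> (\<Sum>y\<in>g ` A. card {x \<in> A. g x = y})" by (intro sum_mono)
  also have "\<dots> = card A"
    using sum.image_gen[OF assms(1), of "\<lambda>_. 1::nat" g] by simp
  finally show ?thesis by simp
qed

text \<open>The trace of a homomorphism from the cycle: the list of images of its edges, of which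
  only the meeting of neighbours and the number of distinct entries are recorded.\<close>

definition chains :: "'a set set \<Rightarrow> nat \<Rightarrow> nat \<Rightarrow> 'a set list set" where
  "chains E i t = {xs. length xs = i \<and> set xs \<subseteq> E \<and> successively (\<lambda>a b. a \<inter> b \<noteq> {}) xs \<and> card (set xs) \<le> t}"

lemma finite_chains: "finite E \<Longrightarrow> finite (chains E i t)"
  by (rule finite_subset[OF _ finite_lists_length_eq[of E i]]) (auto simp: chains_def)

lemma chains_zero: "chains E (Suc i) 0 = {}"
  by (auto simp: chains_def)

text \<open>Prepend one edge at a time. It either repeats one of at most i + 1 earlier edges, or is
  new, meets the head (at most \<open>q\<close> choices) and uses up one of the allowed distinct
  edges. So \<open>q\<close> is paid only for new edges, and the repeats accumulate to the
  factorial.\<close>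

lemma card_chains_le:
  assumes fin: "finite E" and "1 \<le> q" and q: "\<And>a. a \<in> E \<Longrightarrow> card {e \<in> E. e \<inter> a \<noteq> {}} \<le> q"
  shows "card (chains E (Suc i) (Suc t)) \<le> fact (Suc i) * card E * q ^ t"
proof (induction i arbitrary: t)
  case 0
  have "chains E (Suc 0) (Suc t) \<subseteq> (\<lambda>x. [x]) ` E"
    by (auto simp: chains_def length_Suc_conv)
  then have "card (chains E (Suc 0) (Suc t)) \<le> card E"
    using fin by (meson card_image_le card_mono finite_imageI le_trans)
  also have "\<dots> \<le> card E * q ^ t" using \<open>1 \<le> q\<close> by simp
  finally show ?case by simp
next
  case (Suc i)
  let ?N = "\<lambda>xs. {e \<in> E. e \<inter> hd xs \<noteq> {}}"
  let ?A = "Sigma (chains E (Suc i) (Suc t)) set" and ?B = "Sigma (chains E (Suc i) t) ?N"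
  have sub: "chains E (Suc (Suc i)) (Suc t) \<subseteq> (\<lambda>(xs, x). x # xs) ` (?A \<union> ?B)"
  proof
    fix ys assume ys: "ys \<in> chains E (Suc (Suc i)) (Suc t)"
    then obtain x z zs where ys': "ys = x # z # zs"
      by (auto simp: chains_def length_Suc_conv)
    have "(z # zs, x) \<in> ?A \<union> ?B"
    proof (cases "x \<in> set (z # zs)")
      case True
      then have "set (z # zs) = set ys" by (auto simp: ys')
      then show ?thesis using True ys by (auto simp: ys' chains_def)
    next
      case False
      then have "card (set ys) = Suc (card (set (z # zs)))" by (simp add: ys')
      then show ?thesis using ys by (auto simp: ys' chains_def)
    qed
    then show "ys \<in> (\<lambda>(xs, x). x # xs) ` (?A \<union> ?B)" using ys' by force
  qed
  have fA: "finite ?A" and fB: "finite ?B" using finite_chains[OF fin] fin by auto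
  have "card ?A = (\<Sum>xs\<in>chains E (Suc i) (Suc t). card (set xs))"
    using finite_chains[OF fin] by (subst card_SigmaI) auto
  also have "\<dots> \<le> (\<Sum>xs\<in>chains E (Suc i) (Suc t). Suc i)"
  proof (rule sum_mono)
    fix xs assume "xs \<in> chains E (Suc i) (Suc t)"
    then show "card (set xs) \<le> Suc i" using card_length[of xs] by (simp add: chains_def)
  qed
  finally have "card ?A \<le> card (chains E (Suc i) (Suc t)) * Suc i" by simp
  moreover have "card ?B \<le> fact (Suc i) * card E * q ^ t"
  proof (cases t)
    case 0
    then show ?thesis by (simp add: chains_zero)
  next
    case (Suc t')
    have "card ?B = (\<Sum>xs\<in>chains E (Suc i) t. card (?N xs))"
      using finite_chains[OF fin] fin by (subst card_SigmaI) auto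
    also have "\<dots> \<le> (\<Sum>xs\<in>chains E (Suc i) t. q)"
    proof (rule sum_mono)
      fix xs assume "xs \<in> chains E (Suc i) t"
      then have "hd xs \<in> E" by (cases xs) (auto simp: chains_def)
      then show "card (?N xs) \<le> q" by (rule q)
    qed
    also have "\<dots> = card (chains E (Suc i) (Suc t')) * q" by (simp add: Suc)
    also have "\<dots> \<le> (fact (Suc i) * card E * q ^ t') * q" using Suc.IH by (intro mult_right_mono) auto
    finally show ?thesis by (simp add: Suc algebra_simps)
  qed
  moreover have "card (chains E (Suc i) (Suc t)) * Suc i \<le> (fact (Suc i) * card E * q ^ t) * Suc i"
    using Suc.IH by (intro mult_right_mono) auto
  moreover have "card (chains E (Suc (Suc i)) (Suc t)) \<le> card ?A + card ?B"
    using card_mono[OF _ sub] fA fB card_image_le[of "?A \<union> ?B" "\<lambda>(xs, x). x # xs"] card_Un_le[of ?A ?B]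
    by (meson finite_UnI finite_imageI le_trans)
  ultimately have "card (chains E (Suc (Suc i)) (Suc t)) \<le>
     (fact (Suc i) * card E * q ^ t) * Suc i + fact (Suc i) * card E * q ^ t" by linarith
  also have "\<dots> = fact (Suc (Suc i)) * card E * q ^ t" by (simp add: algebra_simps)
  finally show ?case .
qed

lemma finite_homs: "finite (verts F) \<Longrightarrow> finite (verts H) \<Longrightarrow> finite (homs F H)"
  unfolding homs_def by (rule finite_subset[OF _ finite_PiE]) auto

text \<open>If \<open>f i\<close> did not recur within the period, the other k - 1 steps would join
  its two distinct vertices \<open>w (Suc i)\<close> and \<open>w i\<close> while avoiding it.
  Indexing by all naturals makes these steps an interval.\<close>

lemma closed_walk_edge_repeats:
  assumes "berge_free H m" "0 < k" "k \<le> m" and sub: "\<And>e. e \<in> edges H \<Longrightarrow> e \<subseteq> verts H"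
    and f: "\<And>i. f i \<in> edges H" "\<And>i. w i \<in> f i" "\<And>i. w (Suc i) \<in> f i" "\<And>i. w i \<noteq> w (Suc i)"
    and per: "w (i + k) = w i"
  shows "\<exists>j. i < j \<and> j < i + k \<and> f j = f i"
proof (rule ccontr)
  assume c: "\<not> ?thesis"
  have "w (Suc i + t) \<in> reach (edges H - {f i}) (w (Suc i)) t" if "t < k" for t
    using that
  proof (induction t)
    case 0
    then show ?case by simp
  next
    case (Suc t)
    have "f (Suc i + t) \<in> edges H - {f i}" using c f(1) Suc.prems by auto
    then show ?case using Suc f(2)[of "Suc i + t"] f(3)[of "Suc i + t"]
      by (simp del: reach.simps) (rule reach_step, auto)
  qed
  from this[of "k - 1"] have "w i \<in> reach (edges H - {f i}) (w (Suc i)) (k - 1)"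
    using assms(2) per by simp
  then show False
    using not_reach_avoiding[OF assms(1), of "k - 1" "f i" "w (Suc i)" "w i"] assms(2,3) sub f
    by (metis Suc_pred')
qed

text \<open>The trace is a chain with at most \<open>l\<close> distinct edges, and an edge meets at
  most \<open>r * D\<close> edges. Given the trace, each of the \<open>(r - 1) * (2 * l + 1)\<close>
  vertices has at most \<open>r\<close> possible images.\<close>

lemma card_homs_linear_cycle:
  assumes H: "r_graph r H" and "2 \<le> r" "1 \<le> l" and bf: "berge_free H (2 * l + 1)"
    and D: "\<And>u. card {e \<in> edges H. u \<in> e} \<le> D" "1 \<le> D"
  shows "card (homs (linear_cycle r (2 * l + 1)) H) \<le>
     (fact (2 * l + 1) * card (edges H) * (r * D) ^ (l - 1)) * r ^ ((r - 1) * (2 * l + 1))"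
proof -
  define k where "k = 2 * l + 1"
  define N where "N = (r - 1) * k"
  let ?E = "edges H" and ?C = "linear_cycle r k"
  have finV: "finite (verts H)" and sub: "\<And>e. e \<in> ?E \<Longrightarrow> e \<subseteq> verts H" and cE: "\<And>e. e \<in> ?E \<Longrightarrow> card e = r"
    using H by (auto simp: r_graph_def)
  have finE: "finite ?E" using sub finV by (meson Pow_iff finite_Pow_iff finite_subset subsetI)
  have fine: "finite e" if "e \<in> ?E" for e using sub[OF that] finV finite_subset by blast
  define ed where "ed i = (\<lambda>j. ((r - 1) * i + j) mod N) ` {..r - 1}" for i
  have C: "verts ?C = {..<N}" "edges ?C = ed ` {..<k}"
    by (simp_all add: linear_cycle_def ed_def N_def)
  have k0: "0 < k" and N0: "0 < N" using assms(2) by (auto simp: k_def N_def)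
  \<comment> \<open>This extends \<open>ed\<close> periodically to all indices, so that the image of
    the cycle becomes an infinite periodic walk.\<close>
  have per: "((r - 1) * (i mod k) + j) mod N = ((r - 1) * i + j) mod N" for i j
  proof -
    have "(r - 1) * (i mod k) = ((r - 1) * i) mod N" by (simp only: N_def mult_mod_right)
    then show ?thesis by (metis mod_add_left_eq)
  qed
  have ed_mod: "ed (i mod k) = ed i" for i unfolding ed_def by (simp only: per)
  have ed_in: "ed i \<in> edges ?C" for i using ed_mod[of i] k0 C(2) by (metis imageI lessThan_iff mod_less_divisor)
  let ?g = "\<lambda>\<phi>. map (\<lambda>i. \<phi> ` ed i) [0..<k]"
  have g: "?g \<phi> \<in> chains ?E k l" if \<phi>: "\<phi> \<in> homs ?C H" for \<phi>
  proof -
    have fE: "\<phi> ` ed i \<in> ?E" for i using \<phi> ed_in by (auto simp: homs_def)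
    define w where "w i = \<phi> (((r - 1) * i) mod N)" for i
    have w1: "w i \<in> \<phi> ` ed i" for i
      unfolding w_def ed_def by (rule imageI, rule image_eqI[of _ _ 0]) auto
    have w2: "w (Suc i) \<in> \<phi> ` ed i" for i
      unfolding w_def ed_def by (rule imageI, rule image_eqI[of _ _ "r - 1"]) (auto simp: add.commute)
    \<comment> \<open>The image of an edge still has \<open>r\<close> elements, so the map is
      injective on every edge of the cycle.\<close>
    have w3: "w i \<noteq> w (Suc i)" for i
    proof
      assume eq: "w i = w (Suc i)"
      let ?h = "\<lambda>j. \<phi> (((r - 1) * i + j) mod N)"
      have "?h ` {..r - 1} = \<phi> ` ed i" by (auto simp: ed_def)
      then have "card (?h ` {..r - 1}) = card {..r - 1}" using cE[OF fE[of i]] assms(2) by simp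
      then have "inj_on ?h {..r - 1}" by (intro eq_card_imp_inj_on) auto
      moreover have "?h 0 = ?h (r - 1)" using eq by (simp add: w_def add.commute)
      ultimately have "0 = r - 1" by (rule inj_onD) auto
      then show False using assms(2) by simp
    qed
    have w4: "w (i + k) = w i" for i
      using per[of "i + k" 0] per[of i 0] by (simp add: w_def)
    have "\<exists>y\<in>{..<k}. y \<noteq> x \<and> \<phi> ` ed y = \<phi> ` ed x" if "x \<in> {..<k}" for x
    proof -
      obtain j where j: "x < j" "j < x + k" "\<phi> ` ed j = \<phi> ` ed x"
        using closed_walk_edge_repeats[OF bf, of k "\<lambda>i. \<phi> ` ed i" w x] k0 sub fE w1 w2 w3 w4
        by (auto simp: k_def)
      have "j mod k \<noteq> x"
      proof
        assume "j mod k = x"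
        then have "j mod k = x mod k" using that by simp
        then have "k dvd j - x" using j(1) by (simp add: mod_eq_dvd_iff_nat)
        then show False using j(1,2) by (auto dest: dvd_imp_le)
      qed
      then show ?thesis using j(3) ed_mod[of j] k0 by (intro bexI[of _ "j mod k"]) auto
    qed
    then have "2 * card ((\<lambda>i. \<phi> ` ed i) ` {..<k}) \<le> card {..<k}"
      by (intro card_image_le_half) auto
    \<comment> \<open>Rounding (2l + 1)/2 down to \<open>l\<close> is the point where the odd length
      gains.\<close>
    then have "card ((\<lambda>i. \<phi> ` ed i) ` {..<k}) \<le> l" by (simp only: card_lessThan) (simp add: k_def)
    then have "card (set (?g \<phi>)) \<le> l" by (simp only: set_map set_upt atLeast0LessThan)
    moreover have "successively (\<lambda>a b. a \<inter> b \<noteq> {}) (?g \<phi>)"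
      unfolding successively_conv_nth using w1 w2 by (auto simp del: upt_Suc)
    ultimately show ?thesis using fE by (auto simp: chains_def)
  qed
  have fib: "card {\<phi> \<in> homs ?C H. ?g \<phi> = xs} \<le> r ^ N" if xs: "xs \<in> chains ?E k l" for xs
  proof -
    have div: "x div (r - 1) < k" if "x < N" for x
      using that assms(2) by (simp add: N_def less_mult_imp_div_less mult.commute)
    have xsE: "xs ! (x div (r - 1)) \<in> ?E" if "x < N" for x
      using xs div[OF that] by (auto simp: chains_def subset_iff)
    \<comment> \<open>Vertex \<open>x\<close> of the cycle lies in its edge number
      \<open>x div (r - 1)\<close>, so its image is confined to that entry of
      \<open>xs\<close>.\<close>
    have "{\<phi> \<in> homs ?C H. ?g \<phi> = xs} \<subseteq> PiE {..<N} (\<lambda>x. xs ! (x div (r - 1)))"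
    proof
      fix \<phi> assume "\<phi> \<in> {\<phi> \<in> homs ?C H. ?g \<phi> = xs}"
      then have \<phi>: "\<phi> \<in> homs ?C H" "xs = ?g \<phi>" by auto
      have "\<phi> x \<in> xs ! (x div (r - 1))" if "x < N" for x
      proof -
        have "x = ((r - 1) * (x div (r - 1)) + x mod (r - 1)) mod N" using that by simp
        moreover have "x mod (r - 1) \<in> {..r - 1}" using assms(2) by (simp add: less_imp_le)
        ultimately have "x \<in> ed (x div (r - 1))" unfolding ed_def by (rule image_eqI)
        then show ?thesis using div[OF that] \<phi>(2) by simp
      qed
      moreover have "\<phi> \<in> extensional {..<N}" using \<phi>(1) C(1) by (auto simp: homs_def PiE_def)
      ultimately show "\<phi> \<in> PiE {..<N} (\<lambda>x. xs ! (x div (r - 1)))" by (auto simp: PiE_def)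
    qed
    moreover have "finite (PiE {..<N} (\<lambda>x. xs ! (x div (r - 1))))"
      using xsE fine by (intro finite_PiE) auto
    moreover have "card (PiE {..<N} (\<lambda>x. xs ! (x div (r - 1)))) = r ^ N"
      using xsE cE by (simp add: card_PiE)
    ultimately show ?thesis
      using card_mono[of "PiE {..<N} (\<lambda>x. xs ! (x div (r - 1)))"] by simp
  qed
  have "card (homs ?C H) \<le> card (chains ?E k l) * r ^ N"
  proof (rule card_le_fibres[where g = ?g])
    show "finite (homs ?C H)" using finite_homs[of ?C H] C(1) finV by simp
    show "finite (chains ?E k l)" by (rule finite_chains[OF finE])
    show "?g ` homs ?C H \<subseteq> chains ?E k l" using g by blast
  qed (rule fib)
  moreover have "card (chains ?E k l) \<le> fact k * card ?E * (r * D) ^ (l - 1)"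
  proof -
    have "card {e \<in> ?E. e \<inter> a \<noteq> {}} \<le> r * D" if a: "a \<in> ?E" for a
    proof -
      have "{e \<in> ?E. e \<inter> a \<noteq> {}} = (\<Union>u\<in>a. {e \<in> ?E. u \<in> e})" by auto
      then have "card {e \<in> ?E. e \<inter> a \<noteq> {}} \<le> (\<Sum>u\<in>a. card {e \<in> ?E. u \<in> e})"
        using card_UN_le[OF fine[OF a]] by metis
      also have "\<dots> \<le> (\<Sum>u\<in>a. D)" using D(1) by (intro sum_mono)
      finally show ?thesis using cE[OF a] by simp
    qed
    moreover have "1 \<le> r * D" using assms(2) D(2) by (simp add: Suc_le_eq)
    ultimately show ?thesis
      using card_chains_le[OF finE, of "r * D" "2 * l" "l - 1"] assms(3) by (simp add: k_def)
  qed
  ultimately have "card (homs ?C H) \<le> (fact k * card ?E * (r * D) ^ (l - 1)) * r ^ N"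
    by (meson le_trans mult_le_mono1)
  then show ?thesis by (simp add: k_def N_def)
qed

section \<open>Copies and blow-ups\<close>

text \<open>An isomorphism onto a copy, restricted to be extensional, is a homomorphism whose image
  is that copy.\<close>

lemma card_copies_le_homs:
  assumes "finite (verts F)" "finite (verts H)" "\<And>e. e \<in> edges F \<Longrightarrow> e \<subseteq> verts F"
  shows "card (copies F H) \<le> card (homs F H)"
proof -
  let ?g = "\<lambda>\<phi>. (\<phi> ` verts F, (`) \<phi> ` edges F)"
  have "copies F H \<subseteq> ?g ` homs F H"
  proof
    fix X assume "X \<in> copies F H"
    then obtain V E f where X: "X = (V, E)" "V \<subseteq> verts H" "E \<subseteq> edges H"
      and f: "bij_betw f (verts F) V" "(`) f ` edges F = E"
      by (auto simp: copies_def isomorphic_def)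
    let ?f = "restrict f (verts F)"
    have im: "?f ` e = f ` e" if "e \<in> edges F" for e
      using assms(3)[OF that] by (auto simp: image_def subset_iff)
    have "?f ` verts F = V" using f(1) by (auto simp: bij_betw_def)
    moreover have imE: "(`) ?f ` edges F = E" using f(2) im by (metis image_cong)
    moreover have "?f \<in> homs F H"
      using f(1) X im imE by (auto simp: homs_def bij_betw_def)
    ultimately show "X \<in> ?g ` homs F H" using X by (metis (no_types, lifting) image_eqI)
  qed
  then show ?thesis using finite_homs[OF assms(1,2)] by (meson card_image_le card_mono finite_imageI le_trans)
qed

text \<open>The fibres of \<open>p\<close> are the classes of the blow-up. When \<open>E\<close> is
  \<open>r\<close>-uniform, \<open>card e = r\<close> forces \<open>p\<close> to be injective on
  \<open>e\<close>, so the edges are the transversals over edges of \<open>E\<close>.\<close>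

definition blowup :: "nat \<Rightarrow> nat \<Rightarrow> (nat \<Rightarrow> 'a) \<Rightarrow> 'a set set \<Rightarrow> nat hgraph" where
  "blowup r n p E = ({..<n}, {e. e \<subseteq> {..<n} \<and> card e = r \<and> p ` e \<in> E})"

lemma r_graph_blowup: "r_graph r (blowup r n p E)"
  by (auto simp: r_graph_def blowup_def)

text \<open>Composition with \<open>p\<close> gives a homomorphism to \<open>H\<close>, and each of
  those lifts in at most \<open>b\<close> ways per vertex.\<close>

lemma homs_blowup_le:
  assumes "finite (verts F)" "finite (verts H)" "\<And>e. e \<in> edges F \<Longrightarrow> e \<subseteq> verts F"
    "p ` {..<n} \<subseteq> verts H" "\<And>y. y \<in> verts H \<Longrightarrow> card {x \<in> {..<n}. p x = y} \<le> b"
  shows "card (homs F (blowup r n p (edges H))) \<le> card (homs F H) * b ^ card (verts F)"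
proof -
  let ?G = "blowup r n p (edges H)" and ?W = "verts F"
  let ?g = "\<lambda>\<psi>. restrict (p \<circ> \<psi>) ?W"
  have vG: "verts ?G = {..<n}" by (simp add: blowup_def)
  have "?g \<psi> \<in> homs F H" if \<psi>: "\<psi> \<in> homs F ?G" for \<psi>
  proof -
    have "?g \<psi> ` e \<in> edges H" if e: "e \<in> edges F" for e
    proof -
      have "?g \<psi> ` e = p ` \<psi> ` e" using assms(3)[OF e] by (auto simp: image_def subset_iff)
      then show ?thesis using \<psi> e by (auto simp: homs_def blowup_def)
    qed
    moreover have "?g \<psi> \<in> ?W \<rightarrow>\<^sub>E verts H"
      using \<psi> assms(4) by (auto simp: homs_def vG image_subset_iff PiE_iff)
    ultimately show ?thesis by (simp add: homs_def)
  qed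
  moreover have "card {\<psi> \<in> homs F ?G. ?g \<psi> = \<phi>} \<le> b ^ card ?W" if \<phi>: "\<phi> \<in> homs F H" for \<phi>
  proof -
    let ?P = "PiE ?W (\<lambda>x. {z \<in> {..<n}. p z = \<phi> x})"
    have "{\<psi> \<in> homs F ?G. ?g \<psi> = \<phi>} \<subseteq> ?P"
    proof
      fix \<psi> assume "\<psi> \<in> {\<psi> \<in> homs F ?G. ?g \<psi> = \<phi>}"
      then show "\<psi> \<in> ?P" by (auto simp: homs_def vG PiE_iff)
    qed
    moreover have "finite ?P" using assms(1) by (intro finite_PiE) auto
    moreover have "card ?P \<le> b ^ card ?W"
    proof -
      have "card ?P = (\<Prod>x\<in>?W. card {z \<in> {..<n}. p z = \<phi> x})" using assms(1) by (rule card_PiE)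
      also have "\<dots> \<le> (\<Prod>x\<in>?W. b)"
        using \<phi> assms(5) by (intro prod_mono) (auto simp: homs_def)
      finally show ?thesis by simp
    qed
    ultimately show ?thesis by (meson card_mono le_trans)
  qed
  ultimately show ?thesis
    using finite_homs[OF assms(1), of ?G] finite_homs[OF assms(1,2)] vG
    by (intro card_le_fibres[where g = ?g]) auto
qed

text \<open>Choosing a point in the class of every vertex of an edge gives an edge of the blow-up,
  and \<open>p\<close> recovers both the original edge and the choice.\<close>

lemma edges_blowup_ge:
  assumes "r_graph r H" "\<And>y. y \<in> verts H \<Longrightarrow> a \<le> card {x \<in> {..<n}. p x = y}"
  shows "card (edges H) * a ^ r \<le> card (edges (blowup r n p (edges H)))"
proof -
  let ?E = "edges H" and ?G = "blowup r n p (edges H)"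
  let ?T = "\<lambda>f. PiE f (\<lambda>y. {x \<in> {..<n}. p x = y})"
  have finV: "finite (verts H)" and sub: "\<And>e. e \<in> ?E \<Longrightarrow> e \<subseteq> verts H" and cE: "\<And>e. e \<in> ?E \<Longrightarrow> card e = r"
    using assms(1) by (auto simp: r_graph_def)
  have finE: "finite ?E" using sub finV by (meson Pow_iff finite_Pow_iff finite_subset subsetI)
  have fine: "finite e" if "e \<in> ?E" for e using sub[OF that] finV finite_subset by blast
  have "card ?E * a ^ r = (\<Sum>f\<in>?E. a ^ r)" by simp
  also have "\<dots> \<le> (\<Sum>f\<in>?E. card (?T f))"
  proof (rule sum_mono)
    fix f assume f: "f \<in> ?E"
    have "a ^ r = (\<Prod>y\<in>f. a)" using cE[OF f] by simp
    also have "\<dots> \<le> (\<Prod>y\<in>f. card {x \<in> {..<n}. p x = y})"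
      using assms(2) sub[OF f] by (intro prod_mono) auto
    also have "\<dots> = card (?T f)" using fine[OF f] by (simp add: card_PiE)
    finally show "a ^ r \<le> card (?T f)" .
  qed
  also have "\<dots> = card (Sigma ?E ?T)"
    using finE fine by (subst card_SigmaI) (auto intro!: finite_PiE)
  also have "\<dots> \<le> card (edges ?G)"
  proof (rule card_inj_on_le)
    let ?c = "\<lambda>(f, g). g ` (f::'a set)"
    have pg: "p ` g ` f = f" "inj_on g f" if "g \<in> ?T f" for f g
    proof -
      have "p (g y) = y" if "y \<in> f" for y using \<open>g \<in> ?T f\<close> that by auto
      then show "p ` g ` f = f" "inj_on g f" by (force, metis inj_onI)
    qed
    show "inj_on ?c (Sigma ?E ?T)"
    proof (rule inj_onI)
      fix s s' assume s: "s \<in> Sigma ?E ?T" "s' \<in> Sigma ?E ?T" "?c s = ?c s'"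
      obtain f g f' g' where e: "s = (f, g)" "s' = (f', g')" by fastforce
      have ff: "f = f'" using s e pg(1)[of g f] pg(1)[of g' f'] by auto
      have "g y = g' y" for y
      proof (cases "y \<in> f")
        case True
        then have "g y \<in> g' ` f" using s e ff by auto
        then obtain z where z: "z \<in> f" "g y = g' z" by auto
        then have "p (g y) = y" "p (g' z) = z" using s e ff True by (auto simp: PiE_iff)
        then show ?thesis using z by metis
      next
        case False
        then show ?thesis using s e ff by (auto simp: PiE_def extensional_def)
      qed
      then show "s = s'" using e ff by auto
    qed
    show "?c ` Sigma ?E ?T \<subseteq> edges ?G"
    proof
      fix e assume "e \<in> ?c ` Sigma ?E ?T"
      then obtain f g where fg: "f \<in> ?E" "g \<in> ?T f" "e = g ` f" by auto
      have "card e = r" using fg pg(2) cE card_image by metis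
      moreover have "e \<subseteq> {..<n}" using fg by auto
      moreover have "p ` e \<in> ?E" using fg pg(1) by metis
      ultimately show "e \<in> edges ?G" by (simp add: blowup_def)
    qed
    have "edges ?G \<subseteq> Pow {..<n}" by (auto simp: blowup_def)
    then show "finite (edges ?G)" using finite_subset by blast
  qed
  finally show ?thesis .
qed

text \<open>The classes are the residues modulo \<open>card V\<close>.\<close>

lemma balanced_map_exists:
  assumes "finite V" "V \<noteq> {}"
  shows "\<exists>p. p ` {..<n} \<subseteq> V \<and> (\<forall>y\<in>V. n div card V \<le> card {x \<in> {..<n}. p x = y} \<and>
    card {x \<in> {..<n}. p x = y} \<le> n div card V + 1)"
proof -
  define m where "m = card V"
  have m: "0 < m" using assms by (simp add: m_def card_gt_0_iff)
  obtain h where h: "bij_betw h {0..<m} V" using ex_bij_betw_nat_finite[OF assms(1)] m_def by metis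
  have hV: "h (x mod m) \<in> V" for x using h m by (auto simp: bij_betw_def)
  have "n div m \<le> card {x \<in> {..<n}. h (x mod m) = y} \<and> card {x \<in> {..<n}. h (x mod m) = y} \<le> n div m + 1"
    if y: "y \<in> V" for y
  proof -
    obtain j where j: "j < m" "y = h j" using y h by (auto simp: bij_betw_def)
    have eq: "{x \<in> {..<n}. h (x mod m) = y} = {x \<in> {..<n}. x mod m = j}" (is "?L = ?A")
      using h j m by (auto simp: bij_betw_def dest: inj_onD)
    have "card {..<n div m} \<le> card ?A"
    proof (rule card_inj_on_le[where f = "\<lambda>q. q * m + j"])
      show "inj_on (\<lambda>q. q * m + j) {..<n div m}" using m by (auto intro: inj_onI)
      show "(\<lambda>q. q * m + j) ` {..<n div m} \<subseteq> ?A"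
      proof
        fix x assume "x \<in> (\<lambda>q. q * m + j) ` {..<n div m}"
        then obtain q where q: "q < n div m" "x = q * m + j" by auto
        have "x < Suc q * m" using q j by simp
        also have "\<dots> \<le> (n div m) * m" using q by (intro mult_right_mono) auto
        also have "\<dots> \<le> n" by simp
        finally show "x \<in> ?A" using q j by simp
      qed
    qed auto
    moreover have "card ?A \<le> card {..n div m}"
    proof (rule card_inj_on_le[where f = "\<lambda>x. x div m"])
      show "inj_on (\<lambda>x. x div m) ?A"
        by (rule inj_onI) (metis (mono_tags, lifting) div_mult_mod_eq mem_Collect_eq)
      show "(\<lambda>x. x div m) ` ?A \<subseteq> {..n div m}" by (auto intro: div_le_mono)
    qed auto
    ultimately show ?thesis unfolding eq by simp
  qed
  then show ?thesis using hV by (intro exI[of _ "\<lambda>x. h (x mod m)"]) (auto simp: m_def)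
qed

section \<open>Existence of homomorphisms\<close>

lemma bij_with_ends:
  assumes "a < r" "b < r" "a \<noteq> b"
  shows "\<exists>g. bij_betw g {..<r} {..<r} \<and> g 0 = a \<and> g (r - 1) = (b::nat)"
proof -
  let ?S = "{..<r} - {0, r - 1}" and ?T = "{..<r} - {a, b}"
  have r: "2 \<le> r" using assms by auto
  have "card ?S = card ?T" using assms r by (simp add: card_Diff_subset)
  then obtain h where h: "bij_betw h ?S ?T"
    using finite_same_card_bij[of ?S ?T] by auto
  let ?g = "h(0 := a, r - 1 := b)"
  have im: "?g ` ?S = ?T" using h by (auto simp: bij_betw_def image_def)
  have S: "{..<r} = insert 0 (insert (r - 1) ?S)" using r by auto
  have "?g ` {..<r} = insert a (insert b ?T)"
    using r im by (subst S) (simp del: Diff_insert fun_upd_apply, simp)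
  then have "?g ` {..<r} = {..<r}" using assms by auto
  moreover then have "inj_on ?g {..<r}" by (intro eq_card_imp_inj_on) auto
  ultimately show ?thesis using r by (intro exI[of _ ?g]) (auto simp: bij_betw_def)
qed

text \<open>The cycle folds onto a single edge; this gives the positive density demanded in the
  definition of the gap.\<close>

lemma homs_linear_cycle_nonempty:
  assumes "3 \<le> r" "2 \<le> k" "e \<in> edges H" "e \<subseteq> verts H" "card e = r"
  shows "homs (linear_cycle r k) H \<noteq> {}"
proof -
  define N where "N = (r - 1) * k"
  \<comment> \<open>The joints of consecutive edges need a proper colouring of a cycle that may be
    odd, whence the third colour on the last joint and \<open>3 \<le> r\<close>. Each edge is then
    filled in by a bijection with prescribed ends.\<close>
  define c where "c i = (if Suc i = k then 2 else i mod 2 :: nat)" for i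
  have c: "c i < r" "c i \<noteq> c (Suc i mod k)" if "i < k" for i
    using that assms(1,2) by (auto simp: c_def mod_Suc)
  have "\<exists>g. bij_betw g {..<r} {..<r} \<and> g 0 = c i \<and> g (r - 1) = c (Suc i mod k)" if "i < k" for i
    using that c[of i] c(1)[of "Suc i mod k"] by (intro bij_with_ends) auto
  then obtain g where g: "\<And>i. i < k \<Longrightarrow> bij_betw (g i) {..<r} {..<r}" "\<And>i. i < k \<Longrightarrow> g i 0 = c i"
    "\<And>i. i < k \<Longrightarrow> g i (r - 1) = c (Suc i mod k)" by metis
  obtain b where b: "b ` {..<r} = e"
    using ex_bij_betw_nat_finite[of e] assms(1,5)
    by (metis bij_betw_imp_surj_on card.infinite lessThan_atLeast0 not_numeral_le_zero)
  define \<phi> where "\<phi> = restrict (\<lambda>x. b (g (x div (r - 1)) (x mod (r - 1)))) {..<N}"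
  have k0: "0 < k" and N0: "0 < N" using assms by (auto simp: N_def)
  have div: "x div (r - 1) < k" if "x < N" for x
    using that assms(1) by (simp add: N_def less_mult_imp_div_less mult.commute)
  \<comment> \<open>For \<open>j = r - 1\<close> the vertex is stored as the first one of the next
    edge; the two values agree because both are given by the colour of that joint.\<close>
  have val: "\<phi> (((r - 1) * i + j) mod N) = b (g i j)" if i: "i < k" and j: "j \<le> r - 1" for i j
  proof (cases "j = r - 1")
    case True
    have "((r - 1) * i + j) mod N = ((r - 1) * Suc i) mod N" using True by (simp add: add.commute)
    also have "\<dots> = (r - 1) * (Suc i mod k)" by (simp only: N_def mult_mod_right)
    finally have x: "((r - 1) * i + j) mod N = (r - 1) * (Suc i mod k)" .
    have "Suc i mod k < k" using k0 by simp
    moreover then have "(r - 1) * (Suc i mod k) < N" using assms(1) by (simp add: N_def)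
    ultimately have "\<phi> ((r - 1) * (Suc i mod k)) = b (g i (r - 1))"
      using assms(1) g i by (simp add: \<phi>_def)
    then show ?thesis unfolding x using True by simp
  next
    case False
    then have j': "j < r - 1" using j by simp
    have "(r - 1) * i + j < (r - 1) * Suc i" using j' by simp
    also have "\<dots> \<le> N" unfolding N_def using i by (intro mult_left_mono) auto
    finally show ?thesis using j' by (simp add: \<phi>_def)
  qed
  have "\<phi> \<in> homs (linear_cycle r k) H"
    unfolding homs_def
  proof (intro CollectI conjI ballI)
    show "\<phi> \<in> verts (linear_cycle r k) \<rightarrow>\<^sub>E verts H"
    proof -
      have "b (g (x div (r - 1)) (x mod (r - 1))) \<in> verts H" if "x < N" for x
      proof -
        have "x mod (r - 1) < r - 1" using assms(1) by simp
        then have "x mod (r - 1) \<in> {..<r}" by simp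
        then have "g (x div (r - 1)) (x mod (r - 1)) \<in> {..<r}"
          using g(1)[OF div[OF that]] by (metis bij_betwE)
        then show ?thesis using b assms(4) by blast
      qed
      then show ?thesis by (auto simp: linear_cycle_def \<phi>_def N_def)
    qed
    fix d assume "d \<in> edges (linear_cycle r k)"
    then obtain i where i: "i < k" "d = (\<lambda>j. ((r - 1) * i + j) mod N) ` {..r - 1}"
      by (auto simp: linear_cycle_def N_def)
    have "\<phi> ` d = (\<lambda>j. b (g i j)) ` {..r - 1}"
      unfolding i(2) image_image using val[OF i(1)] by (intro image_cong) auto
    also have "{..r - 1} = {..<r}" using assms(1) by auto
    also have "(\<lambda>j. b (g i j)) ` {..<r} = b ` g i ` {..<r}" by (simp add: image_image)
    also have "\<dots> = e" using g(1)[OF i(1)] b by (simp add: bij_betw_def)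
    finally show "\<phi> ` d \<in> edges H" using assms(3) by simp
  qed
  then show ?thesis by auto
qed

text \<open>The strict bound, witnessed by a constant map, keeps the edge density below 1, so that
  its logarithm is negative and can be divided by.\<close>

lemma single_edge_homs:
  assumes H: "r_graph r H" and "2 \<le> r" "verts H \<noteq> {}"
  shows "card (edges H) \<le> card (homs (single_edge r) H)"
    and "card (homs (single_edge r) H) < card (verts H) ^ r"
proof -
  have finV: "finite (verts H)" using H by (simp add: r_graph_def)
  have fin: "finite (homs (single_edge r) H)"
    using finV by (intro finite_homs) (auto simp: single_edge_def)
  have "edges H \<subseteq> (\<lambda>\<phi>. \<phi> ` {..<r}) ` homs (single_edge r) H"
  proof
    fix e assume e: "e \<in> edges H"
    then have ce: "card e = r" "e \<subseteq> verts H" using H by (auto simp: r_graph_def)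
    then obtain b where b: "b ` {..<r} = e"
      using ex_bij_betw_nat_finite[of e] assms(2)
      by (metis bij_betw_imp_surj_on card.infinite lessThan_atLeast0 not_numeral_le_zero)
    have "restrict b {..<r} \<in> homs (single_edge r) H"
      using b ce e by (auto simp: homs_def single_edge_def)
    moreover have "e = restrict b {..<r} ` {..<r}" using b by simp
    ultimately show "e \<in> (\<lambda>\<phi>. \<phi> ` {..<r}) ` homs (single_edge r) H" by (intro image_eqI[of _ _ "restrict b {..<r}"])
  qed
  then show "card (edges H) \<le> card (homs (single_edge r) H)"
    using fin by (meson card_image_le card_mono finite_imageI le_trans)
  obtain v where v: "v \<in> verts H" using assms(3) by auto
  let ?c = "restrict (\<lambda>_. v) {..<r}" and ?P = "{..<r} \<rightarrow>\<^sub>E verts H"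
  have "?c ` {..<r} = {v}" using assms(2) by (auto simp: image_constant_conv lessThan_empty_iff bot_nat_def)
  then have "?c \<notin> homs (single_edge r) H"
    using H assms(2) by (auto simp: homs_def single_edge_def r_graph_def)
  moreover have "?c \<in> ?P" using v by auto
  moreover have "homs (single_edge r) H \<subseteq> ?P" by (auto simp: homs_def single_edge_def)
  ultimately have "homs (single_edge r) H \<subset> ?P" by blast
  moreover have "finite ?P" using finV by (intro finite_PiE) auto
  moreover have "card ?P = card (verts H) ^ r" by (simp add: card_PiE)
  ultimately show "card (homs (single_edge r) H) < card (verts H) ^ r" by (metis psubset_card_mono)
qed

section \<open>Asymptotics\<close>

lemma eventually_le_powr:
  assumes "0 < a"
  shows "\<forall>\<^sub>F n in sequentially. K \<le> real n powr a"
proof -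
  define M where "M = max K 1"
  have "\<forall>\<^sub>F n in sequentially. M powr (1 / a) \<le> real n"
    using eventually_ge_at_top[of "nat \<lceil>M powr (1 / a)\<rceil>"] by eventually_elim linarith
  then show ?thesis
  proof eventually_elim
    case (elim n)
    have "0 < M" by (simp add: M_def)
    have "K \<le> M" by (simp add: M_def)
    also have "M = (M powr (1 / a)) powr a" using assms \<open>0 < M\<close> by (simp add: powr_powr)
    also have "\<dots> \<le> real n powr a" using elim assms by (intro powr_mono2) auto
    finally show ?case .
  qed
qed

lemma exists_error_term:
  fixes c :: "'g \<Rightarrow> nat" and P :: "nat \<Rightarrow> 'g \<Rightarrow> bool"
  assumes "\<And>\<eta>. 0 < \<eta> \<Longrightarrow> \<forall>\<^sub>F n in sequentially. \<exists>H. P n H \<and> real (c H) \<le> real n powr (A + \<eta>)"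
  shows "\<exists>\<epsilon>. \<epsilon> \<longlonglongrightarrow> (0::real) \<and>
    (\<forall>\<^sub>F n in sequentially. \<exists>H. P n H \<and> real (c H) \<le> real n powr (A + \<epsilon> n))"
proof -
  \<comment> \<open>The smallest value of \<open>c\<close> determines the error term; the value 0 is treated separately since
    \<open>ln 0 = 0\<close>.\<close>
  define M where "M n = (LEAST k. \<exists>H. P n H \<and> c H = k)" for n
  have M: "\<exists>H. P n H \<and> c H = M n" if "P n H" for n H
    unfolding M_def by (rule LeastI_ex) (use that in blast)
  have Mle: "M n \<le> c H" if "P n H" for n H
    unfolding M_def by (rule Least_le) (use that in blast)
  define \<epsilon> where "\<epsilon> n = (if M n = 0 then 0 else max 0 (ln (M n) / ln n - A))" for n
  have "\<epsilon> \<longlonglongrightarrow> 0"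
  proof (rule tendstoI)
    fix \<eta> :: real assume "0 < \<eta>"
    then have "\<forall>\<^sub>F n in sequentially. \<exists>H. P n H \<and> real (c H) \<le> real n powr (A + \<eta> / 2)"
      using assms[of "\<eta> / 2"] by simp
    moreover have "\<forall>\<^sub>F n in sequentially. 2 \<le> (n::nat)" by (rule eventually_ge_at_top)
    ultimately show "\<forall>\<^sub>F n in sequentially. dist (\<epsilon> n) 0 < \<eta>"
    proof eventually_elim
      case (elim n)
      then obtain H where H: "P n H" "real (c H) \<le> real n powr (A + \<eta> / 2)" by blast
      show ?case
      proof (cases "M n = 0")
        case True
        then show ?thesis using \<open>0 < \<eta>\<close> by (simp add: \<epsilon>_def)
      next
        case False
        have "real (M n) \<le> real n powr (A + \<eta> / 2)" using Mle[OF H(1)] H(2) by linarith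
        then have "ln (M n) \<le> (A + \<eta> / 2) * ln n"
          using False elim(2) ln_mono[of "real (M n)" "real n powr (A + \<eta> / 2)"]
          by (simp add: ln_powr)
        moreover have "0 < ln (real n)" using elim(2) by simp
        ultimately have "ln (M n) / ln n - A \<le> \<eta> / 2" by (simp add: field_simps)
        moreover have "\<epsilon> n = max 0 (ln (M n) / ln n - A)" using False by (simp add: \<epsilon>_def)
        ultimately show ?thesis using \<open>0 < \<eta>\<close> unfolding dist_real_def by linarith
      qed
    qed
  qed
  moreover have "\<forall>\<^sub>F n in sequentially. \<exists>H. P n H \<and> real (c H) \<le> real n powr (A + \<epsilon> n)"
    \<comment> \<open>Any fixed loss serves here: only the existence of some \<open>H\<close> with
      \<open>P n H\<close> is needed.\<close>
    using assms[of 1, simplified] eventually_ge_at_top[of 2]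
  proof eventually_elim
    case (elim n)
    then obtain H where H: "P n H" "c H = M n" using M by blast
    have "real (M n) \<le> real n powr (A + \<epsilon> n)"
    proof (cases "M n = 0")
      case True
      then show ?thesis by simp
    next
      case False
      have L: "0 < ln (real n)" using elim(2) by simp
      have "ln (M n) / ln n \<le> A + \<epsilon> n" using False by (simp add: \<epsilon>_def)
      then have "ln (M n) \<le> (A + \<epsilon> n) * ln n" using L by (simp add: field_simps)
      then have "exp (ln (M n)) \<le> exp ((A + \<epsilon> n) * ln n)" by simp
      then show ?thesis using False elim(2) by (simp add: powr_def)
    qed
    then show ?case using H by metis
  qed
  ultimately show ?thesis by blast
qed

section \<open>Few cycle homomorphisms in graphs of large girth\<close>

text \<open>Pruning at degree about x/2 costs at most half of the n x edges. Since
  \<open>8 \<le> x\<close>, the remaining degrees exceed the \<open>d\<close> of the Moore bound,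
  which is at least x/4; this gives maximum degree at most
  \<open>n * (4 / x) ^ (l - 1)\<close>.\<close>

lemma nearly_regular_subgraph:
  fixes r l :: nat
  assumes "2 \<le> r" "2 \<le> l"
    and H: "r_graph r H" "berge_free H (2 * l + 1)" "card (verts H) = n" "1 \<le> n"
    and e: "real (card (edges H)) = real n * x" "8 \<le> x"
  shows "\<exists>H'. r_graph r H' \<and> verts H' = verts H \<and> real n * x / 2 \<le> real (card (edges H')) \<and>
     real (card (homs (linear_cycle r (2 * l + 1)) H')) \<le>
       real (fact (2 * l + 1)) * (real n * x) * (real r * (real n * (4 / x) ^ (l - 1))) ^ (l - 1) *
         real r ^ ((r - 1) * (2 * l + 1))"
proof -
  define d where "d = nat \<lfloor>x / 2\<rfloor>"
  have d: "real d \<le> x / 2" "x / 2 - 1 < real d" unfolding d_def using e(2) by linarith+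
  obtain E' where E': "E' \<subseteq> edges H"
    "int (card (edges H)) - int d * int (card (verts H)) \<le> int (card E')"
    "\<forall>u\<in>\<Union>E'. d \<le> card {e \<in> E'. u \<in> e}"
    using prune_min_degree[OF H(1), of d] by blast
  \<comment> \<open>Isolated vertices stay, so the number of vertices that normalises the densities
    is unchanged.\<close>
  define H' where "H' = (verts H, E')"
  have rg: "r_graph r H'" using H(1) E'(1) by (auto simp: H'_def r_graph_def)
  have bf1: "berge_free H' (2 * l + 1)"
    using berge_free_subgraph[of "verts H" "edges H" _ E'] H(2) E'(1) by (simp add: H'_def)
  interpret berge_free_graph H' r l
    using rg assms(1) bf1 by unfold_locales (auto simp: berge_free_def)
  have EH: "E = E'" by (simp add: H'_def)
  have deg_eq: "deg u = card {e \<in> E'. u \<in> e}" for u by (simp add: deg_def EH)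
  have dd: "Suc (d - 1) \<le> deg u" if "u \<in> \<Union>E" for u
    using E'(3) that d(2) e(2) by (auto simp: deg_eq EH)
  define D where "D = real n * (4 / x) ^ (l - 1)"
  have x: "0 < x" using e(2) by simp
  have degD: "real (deg u) \<le> D" for u
  proof -
    have "x / 4 \<le> real (d - 1)" using d(2) e(2) by linarith
    then have "(x / 4) ^ (l - 1) \<le> real (d - 1) ^ (l - 1)" using x by (intro power_mono) auto
    then have "real (deg u) * (x / 4) ^ (l - 1) \<le> real (deg u) * real (d - 1) ^ (l - 1)"
      by (intro mult_left_mono) auto
    also have "\<dots> = real (deg u * (d - 1) ^ (l - 1))" by simp
    also have "\<dots> \<le> real (card (verts H'))"
      using moore_bound[of "d - 1" u] dd assms(2) by (intro of_nat_mono) auto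
    finally have "real (deg u) * (x / 4) ^ (l - 1) \<le> real n" using H(3) by (simp add: H'_def)
    then have "real (deg u) \<le> real n / (x / 4) ^ (l - 1)" using x by (simp add: pos_le_divide_eq)
    also have "\<dots> = D" by (simp add: D_def power_divide)
    finally show ?thesis .
  qed
  have "real (card (edges H)) - real d * real n \<le> real (card E')"
  proof -
    have "real_of_int (int (card (edges H)) - int d * int (card (verts H))) \<le> real_of_int (int (card E'))"
      using E'(2) by (simp only: of_int_le_iff)
    then show ?thesis using H(3) by simp
  qed
  moreover have "real d * real n \<le> (x / 2) * real n" using d(1) by (intro mult_right_mono) auto
  ultimately have half: "real n * x / 2 \<le> real (card E')" using e(1) by (simp add: algebra_simps)
  moreover have "0 < real n * x" using x H(4) by simp
  ultimately have "0 < real (card E')" by linarith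
  then obtain f where f: "f \<in> E'" using card_gt_0_iff by fastforce
  then obtain u where u: "u \<in> f" using edge_other[of f undefined] by (auto simp: EH)
  define D' where "D' = nat \<lfloor>D\<rfloor>"
  have D': "deg u \<le> D'" "real D' \<le> D" for u
  proof -
    have "0 \<le> D" using degD[of u] by (meson of_nat_0_le_iff order_trans)
    then show "real D' \<le> D" by (simp add: D'_def)
    show "deg u \<le> D'" using degD[of u] by (simp add: D'_def le_nat_floor)
  qed
  have "u \<in> \<Union>E" using u f by (auto simp: EH)
  then have "1 \<le> D'" using dd[of u] D'(1)[of u] by linarith
  then have "card (homs (linear_cycle r (2 * l + 1)) H') \<le>
     (fact (2 * l + 1) * card (edges H') * (r * D') ^ (l - 1)) * r ^ ((r - 1) * (2 * l + 1))"
    using D'(1) assms(1,2) by (intro card_homs_linear_cycle[OF rg _ _ bf1]) (auto simp: deg_def)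
  then have "real (card (homs (linear_cycle r (2 * l + 1)) H')) \<le>
     real ((fact (2 * l + 1) * card (edges H') * (r * D') ^ (l - 1)) * r ^ ((r - 1) * (2 * l + 1)))"
    by (rule of_nat_mono)
  also have "\<dots> = real (fact (2 * l + 1)) * real (card E') * (real r * real D') ^ (l - 1) *
      real r ^ ((r - 1) * (2 * l + 1))" by (simp add: H'_def)
  also have "\<dots> \<le> real (fact (2 * l + 1)) * (real n * x) * (real r * D) ^ (l - 1) *
      real r ^ ((r - 1) * (2 * l + 1))"
  proof -
    have "finite (edges H)" using finV H(1) by (auto simp: r_graph_def intro: finite_subset[of _ "Pow (verts H)"])
    then have "real (card E') \<le> real n * x" using card_mono[OF _ E'(1)] e(1) by simp
    moreover have "(real r * real D') ^ (l - 1) \<le> (real r * D) ^ (l - 1)"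
      using D'(2) by (intro power_mono mult_left_mono) auto
    ultimately show ?thesis by (intro mult_right_mono mult_mono) auto
  qed
  finally show ?thesis using rg half unfolding D_def by (intro exI[of _ H']) (simp add: H'_def)
qed

lemma few_cycle_homs:
  fixes r l :: nat
  assumes "2 \<le> r" "2 \<le> l"
    and hyp: "\<exists>\<epsilon> :: nat \<Rightarrow> real. \<epsilon> \<longlonglongrightarrow> 0 \<and>
           (\<forall>\<^sub>F n in sequentially. \<exists>H :: nat hgraph.
              r_graph r H \<and> card (verts H) = n \<and> girth H = enat (2 * l + 2) \<and>
              real (card (edges H)) = real n powr (1 + 1 / real l - \<epsilon> n))"
    and "0 < \<eta>"
  shows "\<forall>\<^sub>F n in sequentially. \<exists>H :: nat hgraph. r_graph r H \<and> card (verts H) = n \<and>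
     real n powr (1 + 1 / real l - \<eta>) \<le> real (card (edges H)) \<and>
     real (card (homs (linear_cycle r (2 * l + 1)) H)) \<le> real n powr (2 + \<eta>)"
proof -
  obtain \<epsilon> where \<epsilon>: "\<epsilon> \<longlonglongrightarrow> 0" "\<forall>\<^sub>F n in sequentially. \<exists>H :: nat hgraph.
      r_graph r H \<and> card (verts H) = n \<and> girth H = enat (2 * l + 2) \<and>
      real (card (edges H)) = real n powr (1 + 1 / real l - \<epsilon> n)"
    using hyp by blast
  \<comment> \<open>A loss of \<open>\<kappa>\<close> in the edge exponent becomes at most
    \<open>\<kappa> * l ^ 2\<close> in the count, which is at most half of \<open>\<eta>\<close> and
    leaves room for the constant \<open>K\<close>. The minimum with 1 ensures
    \<open>\<kappa> < 1 / l\<close>, so that \<open>x\<close> tends to infinity.\<close>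
  define \<kappa> where "\<kappa> = min \<eta> 1 / (2 * real l ^ 2)"
  have l: "2 \<le> real l" using assms(2) by simp
  have l2: "4 \<le> real l ^ 2" using power_mono[OF l, of 2] by simp
  have \<kappa>0: "0 < \<kappa>" using assms(4) l by (simp add: \<kappa>_def)
  have \<kappa>l: "\<kappa> * real l ^ 2 = min \<eta> 1 / 2" using l by (simp add: \<kappa>_def)
  have \<kappa>\<eta>: "\<kappa> * real l ^ 2 < \<eta>" using \<kappa>l assms(4) by linarith
  have "\<kappa> * 1 \<le> \<kappa> * real l ^ 2" using \<kappa>0 l2 by (intro mult_left_mono) auto
  then have \<kappa>\<eta>': "\<kappa> < \<eta>" using \<kappa>\<eta> by simp
  have "\<kappa> * real l ^ 2 < 1" using \<kappa>l by linarith
  moreover have "\<kappa> * real l \<le> \<kappa> * real l ^ 2"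
    using \<kappa>0 l by (intro mult_left_mono self_le_power) auto
  ultimately have "\<kappa> * real l < 1" by linarith
  then have \<kappa>1: "\<kappa> < 1 / real l" using l by (simp add: field_simps)
  define K where "K = real (fact (2 * l + 1)) * (real r * 4 ^ (l - 1)) ^ (l - 1) *
         real r ^ ((r - 1) * (2 * l + 1))"
  have K0: "0 \<le> K" by (simp add: K_def)
  have "\<forall>\<^sub>F n in sequentially. dist (\<epsilon> n) 0 < \<kappa>" using \<epsilon>(1) \<kappa>0 by (rule tendstoD)
  moreover have "\<forall>\<^sub>F n in sequentially. 8 \<le> real n powr (1 / real l - \<kappa>)"
    using \<kappa>1 by (intro eventually_le_powr) auto
  moreover have "\<forall>\<^sub>F n in sequentially. 2 \<le> real n powr (\<eta> - \<kappa>)"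
    using \<kappa>\<eta>' by (intro eventually_le_powr) auto
  moreover have "\<forall>\<^sub>F n in sequentially. K \<le> real n powr (\<eta> - \<kappa> * real l ^ 2)"
    using \<kappa>\<eta> by (intro eventually_le_powr) auto
  ultimately show ?thesis using \<epsilon>(2) eventually_ge_at_top[of 1]
  proof eventually_elim
    case (elim n)
    then obtain H :: "nat hgraph" where H: "r_graph r H" "card (verts H) = n"
      "girth H = enat (2 * l + 2)" "real (card (edges H)) = real n powr (1 + 1 / real l - \<epsilon> n)"
      by blast
    have n: "1 \<le> real n" using elim(6) by simp
    define x where "x = real n powr (1 / real l - \<epsilon> n)"
    have ep: "- \<kappa> < \<epsilon> n" "\<epsilon> n < \<kappa>" using elim(1) by (auto simp: dist_real_def)
    have xlo: "real n powr (1 / real l - \<kappa>) \<le> x" and xhi: "x \<le> real n powr (1 / real l + \<kappa>)"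
      using ep n by (auto simp: x_def intro!: powr_mono)
    have x8: "8 \<le> x" using xlo elim(2) by linarith
    have ex: "real (card (edges H)) = real n * x"
      using H(4) n by (simp add: x_def powr_add[symmetric] powr_mult_base algebra_simps)
    obtain H' where H': "r_graph r H'" "verts H' = verts H" "real n * x / 2 \<le> real (card (edges H'))"
      "real (card (homs (linear_cycle r (2 * l + 1)) H')) \<le>
       real (fact (2 * l + 1)) * (real n * x) * (real r * (real n * (4 / x) ^ (l - 1))) ^ (l - 1) *
         real r ^ ((r - 1) * (2 * l + 1))" (is "_ \<le> ?B")
      using nearly_regular_subgraph[OF assms(1,2) H(1) _ H(2) elim(6) ex x8]
        berge_free_girth[of H "2 * l + 1"] H(3) by auto
    \<comment> \<open>The difference \<open>\<eta> - \<kappa>\<close> pays for the half of the edges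
      lost in pruning.\<close>
    have "real n powr (1 + 1 / real l - \<eta>) * 2 \<le>
        real n powr (1 + 1 / real l - \<eta>) * real n powr (\<eta> - \<kappa>)"
      using elim(3) by (intro mult_left_mono) auto
    also have "\<dots> = real n * real n powr (1 / real l - \<kappa>)"
      using n by (simp add: powr_add[symmetric] powr_mult_base algebra_simps)
    also have "\<dots> \<le> real n * x" using xlo by (intro mult_left_mono) auto
    finally have lo: "real n powr (1 + 1 / real l - \<eta>) \<le> real (card (edges H'))" using H'(3) by linarith
    \<comment> \<open>The maximum degree up to a constant; the Moore bound multiplies the loss
      \<open>\<kappa>\<close> by l - 1.\<close>
    define q where "q = real n powr (1 / real l + \<kappa> * real (l - 1))"
    have "(4 / x) ^ (l - 1) \<le> (4 / real n powr (1 / real l - \<kappa>)) ^ (l - 1)"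
      using xlo x8 elim(2) n by (intro power_mono divide_left_mono mult_pos_pos) auto
    also have "\<dots> = 4 ^ (l - 1) / real n powr ((1 / real l - \<kappa>) * real (l - 1))"
      using n by (simp add: power_divide powr_powr[symmetric] powr_realpow)
    finally have "real n * (4 / x) ^ (l - 1) \<le>
        real n * (4 ^ (l - 1) / real n powr ((1 / real l - \<kappa>) * real (l - 1)))"
      by (intro mult_left_mono) auto
    also have "\<dots> = 4 ^ (l - 1) * real n powr (1 - (1 / real l - \<kappa>) * real (l - 1))"
      using n by (simp add: powr_diff)
    also have "1 - (1 / real l - \<kappa>) * real (l - 1) = 1 / real l + \<kappa> * real (l - 1)"
      using l assms(2) by (simp add: of_nat_diff field_simps)
    finally have q: "real n * (4 / x) ^ (l - 1) \<le> 4 ^ (l - 1) * q" by (simp add: q_def)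
    have "?B \<le> real (fact (2 * l + 1)) * (real n * real n powr (1 / real l + \<kappa>)) *
        (real r * (4 ^ (l - 1) * q)) ^ (l - 1) * real r ^ ((r - 1) * (2 * l + 1))"
    proof -
      have "(real r * (real n * (4 / x) ^ (l - 1))) ^ (l - 1) \<le> (real r * (4 ^ (l - 1) * q)) ^ (l - 1)"
        using q x8 by (intro power_mono mult_left_mono) auto
      then show ?thesis using x8 xhi by (intro mult_right_mono mult_mono mult_left_mono) auto
    qed
    also have "\<dots> = K * (real n * real n powr (1 / real l + \<kappa>) * q ^ (l - 1))"
      by (simp add: K_def power_mult_distrib)
    also have "real n * real n powr (1 / real l + \<kappa>) * q ^ (l - 1) =
        real n powr (1 + (1 / real l + \<kappa>) + (1 / real l + \<kappa> * real (l - 1)) * real (l - 1))"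
      using n by (simp add: q_def powr_add powr_powr[symmetric] powr_realpow)
    also have "1 + (1 / real l + \<kappa>) + (1 / real l + \<kappa> * real (l - 1)) * real (l - 1) =
        2 + \<kappa> * (1 + (real l - 1) ^ 2)"
      using l assms(2) by (simp add: of_nat_diff field_simps power2_eq_square)
    also have "K * real n powr (2 + \<kappa> * (1 + (real l - 1) ^ 2)) \<le> K * real n powr (2 + \<kappa> * real l ^ 2)"
    proof -
      have "1 + (real l - 1) ^ 2 \<le> real l ^ 2" using l by (simp add: power2_eq_square algebra_simps)
      then have "\<kappa> * (1 + (real l - 1) ^ 2) \<le> \<kappa> * real l ^ 2" using \<kappa>0 by simp
      then show ?thesis using K0 n by (intro mult_left_mono powr_mono) auto
    qed
    also have "\<dots> \<le> real n powr (\<eta> - \<kappa> * real l ^ 2) * real n powr (2 + \<kappa> * real l ^ 2)"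
      using elim(4) by (intro mult_right_mono) auto
    also have "\<dots> = real n powr (2 + \<eta>)" by (simp add: powr_add[symmetric] add.commute)
    finally have "?B \<le> real n powr (2 + \<eta>)" .
    then show ?case using H' H(2) lo by (intro exI[of _ H']) auto
  qed
qed

section \<open>From homomorphism counts to the gap and to copies in blow-ups\<close>

text \<open>One graph suffices: with edge density p in (0,1) and \<open>F\<close>-density t > 0, the
  number s = ln t / ln p - e(F) solves the defining equation exactly, and p >= n^(-a), t <= n^(-b)
  give ln t / ln p >= b/a.\<close>

lemma gap_witness:
  fixes H :: "nat hgraph" and a b :: real
  assumes H: "r_graph r H" "card (verts H) = n" and "2 \<le> n" "2 \<le> r"
    and C: "homs F H \<noteq> {}" "finite (verts F)"
    and e: "real n powr (real r - a) \<le> real (card (edges H))" "0 < a"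
    and h: "real (card (homs F H)) \<le> real n powr (real (card (verts F)) - b)" "0 \<le> b"
  shows "ereal (b / a - real (card (edges F))) \<le> sidorenko_gap r F"
proof -
  define t where "t = hom_density F H"
  define p where "p = hom_density (single_edge r) H"
  define L where "L = ln (real n)"
  have L: "0 < L" using assms(3) by (simp add: L_def)
  have n: "0 < real n" using assms(3) by simp
  have finV: "finite (verts H)" and neV: "verts H \<noteq> {}" using H assms(3) by (auto simp: r_graph_def)
  have vS: "card (verts (single_edge r)) = r" by (simp add: single_edge_def)
  have nn: "real n ^ m = real n powr real m" for m using n by (simp add: powr_realpow)
  have "0 < card (homs F H)" using C finite_homs[OF C(2) finV] by (simp add: card_gt_0_iff)
  then have t0: "0 < t" using n H(2) by (simp add: t_def hom_density_def)
  have "t \<le> real n powr (real (card (verts F)) - b) / real n powr real (card (verts F))"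
    unfolding t_def hom_density_def H(2) nn using h(1) by (intro divide_right_mono) auto
  also have "\<dots> = real n powr (- b)" by (simp add: powr_diff[symmetric])
  finally have "ln t \<le> ln (real n powr (- b))" using t0 n by (simp del: ln_powr)
  then have lnt: "b * L \<le> - ln t" using n by (simp add: ln_powr L_def)
  have "real n powr (real r - a) / real n powr real r \<le> p"
    unfolding p_def hom_density_def H(2) nn vS
    using e(1) single_edge_homs(1)[OF H(1) assms(4) neV] by (intro divide_right_mono) (linarith, simp)
  then have pge: "real n powr (- a) \<le> p" by (simp add: powr_diff[symmetric])
  have "0 < real n powr (- a)" using n by simp
  then have p0: "0 < p" using pge by linarith
  have "ln (real n powr (- a)) \<le> ln p" using pge p0 n by (simp del: ln_powr)
  then have lnp: "- ln p \<le> a * L" using n by (simp add: ln_powr L_def)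
  have "real (card (homs (single_edge r) H)) < real (card (verts H) ^ r)"
    using single_edge_homs(2)[OF H(1) assms(4) neV] by (simp only: of_nat_less_iff)
  then have p1: "p < 1" using n by (simp add: p_def hom_density_def vS H(2))
  have lp: "0 < - ln p" using p0 p1 by simp
  define s where "s = ln t / ln p - real (card (edges F))"
  have "p powr (s + real (card (edges F))) = t" using p0 lp t0 by (simp add: s_def powr_def)
  then have "ereal s \<le> sidorenko_gap r F"
    unfolding sidorenko_gap_def using H(1) t0
    by (intro Sup_upper CollectI exI[of _ s] conjI refl exI[of _ H]) (simp_all add: t_def p_def)
  moreover have "b / a \<le> ln t / ln p"
  proof -
    have "b / a = (b * L) / (a * L)" using L by simp
    also have "\<dots> \<le> (- ln t) / (- ln p)" using lnt lnp lp mult_nonneg_nonneg[OF h(2) less_imp_le[OF L]]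
      by (intro frac_le) linarith+
    finally show ?thesis by simp
  qed
  then have "ereal (b / a - real (card (edges F))) \<le> ereal s" by (simp add: s_def)
  ultimately show ?thesis by (rule order_trans[rotated])
qed

text \<open>Because \<open>m \<le> n\<close>, both \<open>n div m\<close> and
  \<open>n div m + 1\<close> are within a factor 2 of n/m.\<close>

lemma blowup_bounds:
  fixes H :: "nat hgraph"
  assumes H: "r_graph r H" "card (verts H) = m" "1 \<le> m" "m \<le> n"
    and F: "finite (verts F)" "\<And>e. e \<in> edges F \<Longrightarrow> e \<subseteq> verts F"
  shows "\<exists>G :: nat hgraph. r_graph r G \<and> card (verts G) = n \<and>
    real (card (edges H)) * (real n / (2 * real m)) ^ r \<le> real (card (edges G)) \<and>
    real (card (copies F G)) \<le> real (card (homs F H)) * (2 * real n / real m) ^ card (verts F)"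
proof -
  have finV: "finite (verts H)" and neV: "verts H \<noteq> {}" using H by (auto simp: r_graph_def)
  obtain p where p: "p ` {..<n} \<subseteq> verts H"
    "\<And>y. y \<in> verts H \<Longrightarrow> n div m \<le> card {x \<in> {..<n}. p x = y}"
    "\<And>y. y \<in> verts H \<Longrightarrow> card {x \<in> {..<n}. p x = y} \<le> n div m + 1"
    using balanced_map_exists[OF finV neV, of n] H(2) by auto
  let ?G = "blowup r n p (edges H)"
  have q: "1 \<le> n div m" using H(3,4) by (simp add: Suc_le_eq div_greater_zero_iff)
  have "n = m * (n div m) + n mod m" by simp
  moreover have "n mod m < m" using H(3) by simp
  moreover have "m * 1 \<le> m * (n div m)" using q by (intro mult_left_mono) auto
  ultimately have "n \<le> 2 * (m * (n div m))" "m * (n div m) + m \<le> 2 * n"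
    by linarith+
  then have "n \<le> 2 * (m * (n div m))" "m * (n div m + 1) \<le> 2 * n"
    by simp_all
  then have "real n \<le> real (2 * (m * (n div m)))" "real (m * (n div m + 1)) \<le> real (2 * n)"
    by (simp_all only: of_nat_le_iff)
  then have b: "real n / (2 * real m) \<le> real (n div m)" "real (n div m + 1) \<le> 2 * real n / real m"
    using H(3) by (simp_all add: field_simps)
  have "real (card (edges H)) * (real n / (2 * real m)) ^ r \<le> real (card (edges H)) * real (n div m) ^ r"
    using b(1) by (intro mult_left_mono power_mono) auto
  also have "\<dots> = real (card (edges H) * (n div m) ^ r)" by simp
  also have "\<dots> \<le> real (card (edges ?G))"
    using edges_blowup_ge[OF H(1) p(2)] by (simp only: of_nat_le_iff)
  finally have 1: "real (card (edges H)) * (real n / (2 * real m)) ^ r \<le> real (card (edges ?G))" .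
  have vG: "verts ?G = {..<n}" by (simp add: blowup_def)
  have "card (copies F ?G) \<le> card (homs F ?G)" using F vG by (intro card_copies_le_homs) auto
  also have "\<dots> \<le> card (homs F H) * (n div m + 1) ^ card (verts F)"
    using F finV p by (intro homs_blowup_le) auto
  finally have "real (card (copies F ?G)) \<le> real (card (homs F H) * (n div m + 1) ^ card (verts F))"
    by (rule of_nat_mono)
  also have "\<dots> = real (card (homs F H)) * real (n div m + 1) ^ card (verts F)" by simp
  also have "\<dots> \<le> real (card (homs F H)) * (2 * real n / real m) ^ card (verts F)"
    using b(2) by (intro mult_left_mono power_mono) auto
  finally show ?thesis using 1 r_graph_blowup vG by (intro exI[of _ ?G]) simp
qed

text \<open>Blow-ups preserve densities up to constants. Starting from m = n^(\<delta>/a) vertices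
  turns edge density m^(-a) into n^(-\<delta>) and \<open>F\<close>-density m^(-b) into n^(-\<delta>
  b/a).\<close>

lemma few_copies:
  fixes a b \<delta> \<eta> :: real
  assumes F: "finite (verts F)" "\<And>e. e \<in> edges F \<Longrightarrow> e \<subseteq> verts F"
    and "1 \<le> a" "0 < b" "b \<le> real (card (verts F))" "0 < \<delta>" "\<delta> < 1" "0 < \<eta>"
    and few: "\<And>\<rho>. 0 < \<rho> \<Longrightarrow> \<forall>\<^sub>F m in sequentially. \<exists>H :: nat hgraph.
      r_graph r H \<and> card (verts H) = m \<and>
      real m powr (real r - a - \<rho>) \<le> real (card (edges H)) \<and>
      real (card (homs F H)) \<le> real m powr (real (card (verts F)) - b + \<rho>)"
  shows "\<forall>\<^sub>F n in sequentially. \<exists>G :: nat hgraph. r_graph r G \<and> card (verts G) = n \<and>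
      real n powr (real r - \<delta>) \<le> real (card (edges G)) \<and>
      real (card (copies F G)) \<le> real n powr (real (card (verts F)) - \<delta> * b / a + \<eta>)"
proof -
  define V where "V = card (verts F)"
  \<comment> \<open>In \<open>a + 2 * \<rho>\<close> one \<open>\<rho>\<close> covers the loss in
    \<open>few\<close> and the other is slack. The exponent tends to
    \<open>\<delta> * b / a\<close>, so a small \<open>\<rho>\<close> costs at most half of
    \<open>\<eta>\<close>.\<close>
  have "((\<lambda>\<rho>. \<delta> / (a + 2 * \<rho>) * (b - \<rho>)) \<longlongrightarrow> \<delta> / (a + 2 * 0) * (b - 0)) (at_right 0)"
    using assms(3) by (intro tendsto_intros) auto
  then have "\<forall>\<^sub>F \<rho> in at_right 0. \<delta> * b / a - \<eta> / 2 < \<delta> / (a + 2 * \<rho>) * (b - \<rho>)"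
    using assms(8) by (intro order_tendstoD(1)) auto
  moreover have "\<forall>\<^sub>F \<rho> in at_right (0::real). \<rho> < b"
    unfolding eventually_at_right_field using assms(4) by (intro exI[of _ b]) auto
  ultimately have "\<forall>\<^sub>F \<rho> in at_right 0. 0 < \<rho> \<and> \<rho> < b \<and> \<delta> * b / a - \<eta> / 2 < \<delta> / (a + 2 * \<rho>) * (b - \<rho>)"
    using eventually_at_right_less[of 0] by eventually_elim simp
  then obtain \<rho> where \<rho>: "0 < \<rho>" "\<rho> < b" "\<delta> * b / a - \<eta> / 2 < \<delta> / (a + 2 * \<rho>) * (b - \<rho>)"
    using eventually_happens' trivial_limit_at_right_real by blast
  \<comment> \<open>Blowing up from \<open>n powr \<theta>\<close> vertices, the slack \<open>\<theta> * \<rho>\<close> in the edge exponent absorbs the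
    constant factors.\<close>
  define \<theta> where "\<theta> = \<delta> / (a + 2 * \<rho>)"
  have \<theta>0: "0 < \<theta>" using assms(3,6) \<rho>(1) by (simp add: \<theta>_def)
  have \<theta>1: "\<theta> < 1" using assms(3,6,7) \<rho>(1) by (simp add: \<theta>_def field_simps)
  have \<theta>a: "\<theta> * (a + \<rho>) = \<delta> - \<theta> * \<rho>" using assms(3) \<rho>(1) by (simp add: \<theta>_def field_simps)
  define m where "m n = nat \<lfloor>real n powr \<theta>\<rfloor>" for n
  have "\<forall>\<^sub>F n in sequentially. k \<le> m n" for k
    using eventually_le_powr[OF \<theta>0, of "real k"] by eventually_elim (simp add: m_def le_nat_floor)
  then have "filterlim m sequentially sequentially" by (simp add: filterlim_at_top)
  then have "\<forall>\<^sub>F n in sequentially. \<exists>H :: nat hgraph. r_graph r H \<and> card (verts H) = m n \<and>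
      real (m n) powr (real r - a - \<rho>) \<le> real (card (edges H)) \<and>
      real (card (homs F H)) \<le> real (m n) powr (real V - b + \<rho>)"
    using few[OF \<rho>(1)] unfolding V_def by (rule eventually_compose_filterlim[rotated])
  moreover have "\<forall>\<^sub>F n in sequentially. 2 ^ r \<le> real n powr (\<theta> * \<rho>)"
    using \<theta>0 \<rho>(1) by (intro eventually_le_powr) auto
  moreover have "\<forall>\<^sub>F n in sequentially. 4 ^ V \<le> real n powr (\<eta> / 2)"
    using assms(8) by (intro eventually_le_powr) auto
  ultimately show ?thesis using eventually_ge_at_top[of 1]
  proof eventually_elim
    case (elim n)
    define M where "M = real (m n)"
    obtain H :: "nat hgraph" where H: "r_graph r H" "card (verts H) = m n"
      "M powr (real r - a - \<rho>) \<le> real (card (edges H))"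
      "real (card (homs F H)) \<le> M powr (real V - b + \<rho>)"
      using elim(1) unfolding M_def by blast
    have n: "1 \<le> real n" using elim(4) by simp
    have n\<theta>: "1 \<le> real n powr \<theta>" using n \<theta>0 by (simp add: ge_one_powr_ge_zero)
    \<comment> \<open>Rounding a number that is at least 1 down to an integer loses at most a factor
      2.\<close>
    have M: "1 \<le> M" "M \<le> real n powr \<theta>" "real n powr \<theta> \<le> 2 * M"
    proof -
      have "1 \<le> real_of_int \<lfloor>real n powr \<theta>\<rfloor>" using n\<theta> by simp
      moreover have "M = real_of_int \<lfloor>real n powr \<theta>\<rfloor>" by (simp add: M_def m_def)
      ultimately show "1 \<le> M" "M \<le> real n powr \<theta>" "real n powr \<theta> \<le> 2 * M"
        by linarith+
    qed
    have "real n powr \<theta> \<le> real n powr 1" using n \<theta>1 by (intro powr_mono) auto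
    then have "M \<le> real n" using M(2) n by simp
    then have mn: "1 \<le> m n" "m n \<le> n" using M(1) by (simp_all add: M_def)
    obtain G :: "nat hgraph" where G: "r_graph r G" "card (verts G) = n"
      "real (card (edges H)) * (real n / (2 * M)) ^ r \<le> real (card (edges G))"
      "real (card (copies F G)) \<le> real (card (homs F H)) * (2 * real n / M) ^ V"
      using blowup_bounds[OF H(1,2) mn F] unfolding M_def V_def by blast
    have nn: "x ^ k = x powr real k" if "0 < x" for x :: real and k using that by (simp add: powr_realpow)
    have "real n powr (real r - \<delta>) * 2 ^ r \<le> real n powr (real r - \<delta>) * real n powr (\<theta> * \<rho>)"
      using elim(2) by (intro mult_left_mono) auto
    also have "\<dots> = real n powr real r * (real n powr \<theta>) powr (- (a + \<rho>))"
    proof -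
      have "real r - \<delta> + \<theta> * \<rho> = real r + \<theta> * (- (a + \<rho>))" using \<theta>a by (simp only: mult_minus_right)
      then show ?thesis by (simp only: powr_powr powr_add[symmetric])
    qed
    also have "\<dots> \<le> real n powr real r * M powr (- (a + \<rho>))"
      using M assms(3) \<rho>(1) by (intro mult_left_mono powr_mono2') auto
    also have "\<dots> = M powr (real r - a - \<rho>) * (real n powr real r / M powr real r)"
      using M(1) by (simp add: powr_diff powr_minus field_simps powr_add)
    also have "\<dots> \<le> real (card (edges H)) * (real n powr real r / M powr real r)"
      using H(3) by (intro mult_right_mono) auto
    also have "\<dots> = real (card (edges H)) * (real n / (2 * M)) ^ r * 2 ^ r"
      using n M(1) by (simp add: nn[symmetric] power_divide power_mult_distrib)
    also have "\<dots> \<le> real (card (edges G)) * 2 ^ r" using G(3) by (intro mult_right_mono) auto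
    finally have 1: "real n powr (real r - \<delta>) \<le> real (card (edges G))" by simp
    have "real (card (copies F G)) \<le> M powr (real V - b + \<rho>) * (2 * real n / M) ^ V"
      using G(4) H(4) M(1) by (meson mult_right_mono order_trans divide_nonneg_nonneg of_nat_0_le_iff zero_le_power mult_nonneg_nonneg zero_le_numeral zero_le_one)
    also have "\<dots> = 2 ^ V * real n powr real V * M powr (- (b - \<rho>))"
      using n M(1) by (simp add: nn[symmetric] power_divide power_mult_distrib powr_add powr_diff powr_minus field_simps)
    \<comment> \<open>This halving costs at most another \<open>2 ^ V\<close>, since
      \<open>b - \<rho>\<close> is at most \<open>V\<close>; hence the \<open>4 ^ V\<close> absorbed
      by the second half of \<open>\<eta>\<close>.\<close>
    also have "\<dots> \<le> 2 ^ V * real n powr real V * (real n powr \<theta> / 2) powr (- (b - \<rho>))"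
      using n M n\<theta> \<rho>(2) by (intro mult_left_mono powr_mono2') auto
    also have "(real n powr \<theta> / 2) powr (- (b - \<rho>)) = real n powr (- (\<theta> * (b - \<rho>))) * 2 powr (b - \<rho>)"
      using n by (simp add: powr_divide powr_powr powr_add[symmetric] field_simps)
    also have "2 ^ V * real n powr real V * \<dots> \<le> 2 ^ V * real n powr real V * (real n powr (\<eta> / 2 - \<delta> * b / a) * 2 ^ V)"
    proof -
      have "real n powr (- (\<theta> * (b - \<rho>))) \<le> real n powr (\<eta> / 2 - \<delta> * b / a)"
        using n \<rho>(3) by (intro powr_mono) (auto simp: \<theta>_def)
      moreover have "(2::real) powr (b - \<rho>) \<le> 2 powr real V"
        using assms(5) \<rho>(1) by (intro powr_mono) (auto simp: V_def)
      ultimately show ?thesis by (intro mult_left_mono mult_mono) (auto simp: powr_realpow)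
    qed
    also have "\<dots> = 4 ^ V * real n powr (real V - \<delta> * b / a + \<eta> / 2)"
      using n by (simp add: powr_add[symmetric] power_mult_distrib[symmetric] algebra_simps)
    also have "\<dots> \<le> real n powr (\<eta> / 2) * real n powr (real V - \<delta> * b / a + \<eta> / 2)"
      using elim(3) by (intro mult_right_mono) auto
    also have "\<dots> = real n powr (real V - \<delta> * b / a + \<eta>)" by (simp add: powr_add[symmetric] add.commute)
    finally show ?case using G(1,2) 1 unfolding V_def by (intro exI[of _ G]) simp
  qed
qed

theorem theorem1p8:
  fixes r l :: nat
  assumes "r \<ge> 3" and "l \<ge> 2"
    and "\<exists>\<epsilon> :: nat \<Rightarrow> real. \<epsilon> \<longlonglongrightarrow> 0 \<and>
           (\<forall>\<^sub>F n in sequentially. \<exists>H :: nat hgraph.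
              r_graph r H \<and> card (verts H) = n \<and> girth H = enat (2 * l + 2) \<and>
              real (card (edges H)) = real n powr (1 + 1 / real l - \<epsilon> n))"
  shows "sidorenko_gap r (linear_cycle r (2 * l + 1)) \<ge> ereal (1 / ((real r - 1) * real l - 1))
    \<and> (\<forall>\<delta> :: real. 0 < \<delta> \<and> \<delta> < 1 \<longrightarrow>
         (\<exists>\<epsilon> :: nat \<Rightarrow> real. \<epsilon> \<longlonglongrightarrow> 0 \<and>
           (\<forall>\<^sub>F n in sequentially. \<exists>H :: nat hgraph.
              r_graph r H \<and> card (verts H) = n \<and>
              real (card (edges H)) \<ge> real n powr (real r - \<delta>) \<and>
              real (card (copies (linear_cycle r (2 * l + 1)) H)) \<le>
                real n powr ((real r - 1) * (2 * real l + 1)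
                  - \<delta> * (2 * real l + 1 + 1 / ((real r - 1) * real l - 1)) + \<epsilon> n))))"
proof -
  let ?C = "linear_cycle r (2 * l + 1)"
  define a where "a = real r - 1 - 1 / real l"
  define b where "b = real (card (verts ?C)) - 2"
  have V: "real (card (verts ?C)) = (real r - 1) * (2 * real l + 1)"
  proof -
    have "card (verts ?C) = (r - 1) * (2 * l + 1)" by (simp add: linear_cycle_def)
    moreover have "real (r - 1) = real r - 1" using assms(1) by (simp add: of_nat_diff)
    ultimately show ?thesis by (simp only: of_nat_mult of_nat_add of_nat_numeral of_nat_1)
  qed
  have finC: "finite (verts ?C)" by (simp add: linear_cycle_def)
  have subC: "e \<subseteq> verts ?C" if "e \<in> edges ?C" for e
    using that assms(1) by (auto simp: linear_cycle_def)
  have rl: "3 \<le> real r" "2 \<le> real l" using assms(1,2) by simp_all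
  have "1 / real l \<le> 1 / 2" using rl by (intro divide_left_mono) auto
  then have a1: "1 \<le> a" using rl(1) by (simp add: a_def)
  have "2 * 5 \<le> (real r - 1) * (2 * real l + 1)" using rl by (intro mult_mono) auto
  then have b0: "8 \<le> b" using V by (simp add: b_def)
  have "4 \<le> (real r - 1) * real l" using mult_mono[of 2 "real r - 1" 2 "real l"] rl by simp
  then have key: "b / a = 2 * real l + 1 + 1 / ((real r - 1) * real l - 1)"
    using rl unfolding a_def b_def V by (simp add: field_simps)
  have few: "\<forall>\<^sub>F n in sequentially. \<exists>H :: nat hgraph. r_graph r H \<and> card (verts H) = n \<and>
     real n powr (real r - a - \<eta>) \<le> real (card (edges H)) \<and>
     real (card (homs ?C H)) \<le> real n powr (real (card (verts ?C)) - b + \<eta>)" if "0 < \<eta>" for \<eta>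
    using few_cycle_homs[OF _ assms(2,3) that] assms(1) by (simp add: a_def b_def)
  \<comment> \<open>The number of edges is subtracted in the gap, so an upper bound is the direction
    required.\<close>
  have cE: "real (card (edges ?C)) \<le> 2 * real l + 1"
  proof -
    have "card (edges ?C) \<le> card {..<2 * l + 1}" unfolding linear_cycle_def snd_conv
      by (intro card_image_le) simp
    then show ?thesis by simp
  qed
  have gap: "ereal ((b - \<eta>) / (a + \<eta>) - (2 * real l + 1)) \<le> sidorenko_gap r ?C"
    if \<eta>: "0 < \<eta>" "\<eta> < 1" for \<eta>
  proof -
    have "\<forall>\<^sub>F n in sequentially. ereal ((b - \<eta>) / (a + \<eta>) - real (card (edges ?C))) \<le> sidorenko_gap r ?C"
      using few[OF \<eta>(1)] eventually_ge_at_top[of 2]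
    proof eventually_elim
      case (elim n)
      then obtain H :: "nat hgraph" where H: "r_graph r H" "card (verts H) = n"
        "real n powr (real r - (a + \<eta>)) \<le> real (card (edges H))"
        "real (card (homs ?C H)) \<le> real n powr (real (card (verts ?C)) - (b - \<eta>))"
        by (auto simp: algebra_simps)
      have "0 < real n powr (real r - (a + \<eta>))" using elim(2) by simp
      then have "edges H \<noteq> {}" using H(3) by auto
      then obtain e where "e \<in> edges H" by blast
      then have "homs ?C H \<noteq> {}"
        using homs_linear_cycle_nonempty[of r "2 * l + 1" e H] assms(1,2) H(1)
        by (auto simp: r_graph_def)
      then show ?case
        using gap_witness[OF H(1,2) elim(2) _ _ finC H(3) _ H(4)] assms(1) a1 b0 \<eta> by simp
    qed
    \<comment> \<open>The inequality does not mention n, so one sufficiently large n establishes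
      it.\<close>
    then have "ereal ((b - \<eta>) / (a + \<eta>) - real (card (edges ?C))) \<le> sidorenko_gap r ?C" by simp
    then show ?thesis using cE by (elim order_trans[rotated]) simp
  qed
  \<comment> \<open>The gap does not depend on \<open>\<eta>\<close>, so its lower bounds pass to
    the limit.\<close>
  have "((\<lambda>\<eta>. ereal ((b - \<eta>) / (a + \<eta>) - (2 * real l + 1))) \<longlongrightarrow>
      ereal ((b - 0) / (a + 0) - (2 * real l + 1))) (at_right 0)"
    using a1 by (intro tendsto_intros) auto
  moreover have "\<forall>\<^sub>F \<eta> in at_right 0. ereal ((b - \<eta>) / (a + \<eta>) - (2 * real l + 1)) \<le> sidorenko_gap r ?C"
    unfolding eventually_at_right_field using gap by (intro exI[of _ 1]) auto
  ultimately have "ereal ((b - 0) / (a + 0) - (2 * real l + 1)) \<le> sidorenko_gap r ?C"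
    by (rule tendsto_upperbound) simp
  then have part1: "ereal (1 / ((real r - 1) * real l - 1)) \<le> sidorenko_gap r ?C"
    using key by simp
  have "\<exists>\<epsilon> :: nat \<Rightarrow> real. \<epsilon> \<longlonglongrightarrow> 0 \<and>
      (\<forall>\<^sub>F n in sequentially. \<exists>H :: nat hgraph.
        (r_graph r H \<and> card (verts H) = n \<and> real n powr (real r - \<delta>) \<le> real (card (edges H))) \<and>
        real (card (copies ?C H)) \<le> real n powr (real (card (verts ?C)) - \<delta> * b / a + \<epsilon> n))"
    if "0 < \<delta>" "\<delta> < 1" for \<delta>
  proof (rule exists_error_term)
    fix \<eta> :: real assume "0 < \<eta>"
    then show "\<forall>\<^sub>F n in sequentially. \<exists>H :: nat hgraph.
        (r_graph r H \<and> card (verts H) = n \<and> real n powr (real r - \<delta>) \<le> real (card (edges H))) \<and>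
        real (card (copies ?C H)) \<le> real n powr (real (card (verts ?C)) - \<delta> * b / a + \<eta>)"
      using few_copies[OF finC subC a1 _ _ that _ few] b0 by (simp add: conj_assoc b_def)
  qed
  moreover have "\<delta> * b / a = \<delta> * (2 * real l + 1 + 1 / ((real r - 1) * real l - 1))" for \<delta>
    using key by (metis times_divide_eq_right)
  ultimately show ?thesis using part1 V by (simp add: conj_assoc)
qed

end
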